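(* Let $1<p\leqslant 2$, let $0<\varepsilon\leqslant 1$, let $k\geqslant 2$ be an integer, and set \[ C=C(p,\varepsilon,k)\coloneqq \exp\Big(\frac{34}{\varepsilon^8(p-1)^2}\,k^2\Big). \] Let $n\geqslant C$ be an integer and let $\boldsymbol{X}=\langle X_s:s\in\binom{[n]}{2}\rangle$ be a $\{0,1\}$-valued, $(1/C)$-spreadable, two-dimensional random array on $[n]$ such that \[ \big|\mathbb{E}[X_{\{1,3\}}X_{\{1,4\}}X_{\{2,3\}}X_{\{2,4\}}]-\mathbb{E}[X_{\{1,3\}}]\,\mathbb{E}[X_{\{1,4\}}]\,\mathbb{E}[X_{\{2,3\}}]\,\mathbb{E}[X_{\{2,4\}}]\big|\leqslant \frac1C. \] Then for every function $f\colon\{0,1\}^{\binom{[n]}{2}}\to\mathbb{R}$ with $\mathbb{E}[f(\boldsymbol{X})]=0$ and $\|f(\boldsymbol{X})\|_{L_p}=1$ there exists an interval $I$ of $[n]$ with $|I|=k$ such that for every $J\subseteq I$ with $|J|\geqslant 2$ we have \[ \mathbb{P}\big(\big|\mathbb{E}[f(\boldsymbol{X})\,|\,\mathcal{F}_J]\big|\leqslant\varepsilon\big)\geqslant 1-\varepsilon. \]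
   Context: $[n]=\{1,\dots,n\}$ and $\binom{I}{d}$ denotes the set of $d$-element subsets of $I$. A $d$-dimensional random array on a set $I$ is a stochastic process $\boldsymbol{X}=\langle X_s:s\in\binom{I}{d}\rangle$. For $J\subseteq I$ with $|J|\geqslant d$, the subarray $\boldsymbol{X}_J=\langle X_s:s\in\binom{J}{d}\rangle$ and $\mathcal{F}_J=\sigma(\{X_s:s\in\binom{J}{d}\})$. For $\eta\geqslant0$, a $d$-dimensional random array $\boldsymbol{X}$ on $[n]$ is $\eta$-spreadable if for every pair $J,K\subseteq[n]$ with $|J|=|K|\geqslant d$ the total variation distance between the laws of $\boldsymbol{X}_J$ and $\boldsymbol{X}_K$ is at most $\eta$ (the two subarrays are compared by identifying $\binom{J}{d}$ and $\binom{K}{d}$ via the unique increasing bijection $J\to K$). An interval of $[n]$ is a set of consecutive integers in $[n]$. *)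

theory Defs
  imports "HOL-Probability.Probability"
begin

definition binom :: "nat set \<Rightarrow> nat \<Rightarrow> nat set set" where
  "binom I d = {s. s \<subseteq> I \<and> card s = d}"

definition subarray_cfg ::
  "(nat set \<Rightarrow> 'a \<Rightarrow> real) \<Rightarrow> nat \<Rightarrow> nat set \<Rightarrow> 'a \<Rightarrow> (nat set \<Rightarrow> real)" where
  "subarray_cfg X d J \<omega> =
     (\<lambda>t. if t \<in> binom {0..<card J} d
          then X ((\<lambda>i. sorted_list_of_set J ! i) ` t) \<omega> else 0)"

text \<open>eta-spreadability on [n] = {1..n}: total variation distance (sup over all events)
  between the laws of X_J and X_K is at most eta.\<close>
definition spreadable ::
  "'a measure \<Rightarrow> (nat set \<Rightarrow> 'a \<Rightarrow> real) \<Rightarrow> nat \<Rightarrow> nat \<Rightarrow> real \<Rightarrow> bool" where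
  "spreadable M X d n \<eta> \<longleftrightarrow>
     (\<forall>J K. J \<subseteq> {1..n} \<and> K \<subseteq> {1..n} \<and> card J = card K \<and> card J \<ge> d \<longrightarrow>
        (\<forall>A :: (nat set \<Rightarrow> real) set.
           \<bar>measure M {\<omega> \<in> space M. subarray_cfg X d J \<omega> \<in> A}
            - measure M {\<omega> \<in> space M. subarray_cfg X d K \<omega> \<in> A}\<bar> \<le> \<eta>))"

definition gen_sigma ::
  "'a measure \<Rightarrow> (nat set \<Rightarrow> 'a \<Rightarrow> real) \<Rightarrow> nat \<Rightarrow> nat set \<Rightarrow> 'a measure" where
  "gen_sigma M X d J =
     sigma (space M) {X s -` B \<inter> space M | s B. s \<in> binom J d \<and> B \<in> sets borel}"

definition apply_array ::
  "((nat set \<Rightarrow> real) \<Rightarrow> real) \<Rightarrow> (nat set \<Rightarrow> 'a \<Rightarrow> real) \<Rightarrow> nat \<Rightarrow> nat \<Rightarrow> 'a \<Rightarrow> real" where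
  "apply_array f X d n \<omega> = f (\<lambda>s. if s \<in> binom {1..n} d then X s \<omega> else 0)"

end

theory Submission
  imports Defs
begin

text \<open>
  By spreadability and the box condition the array is quasirandom, in the sense that
  every edge variable is nearly uncorrelated, after centring, with functions of the other edges.
  Indeed, if the edge \<open>ij\<close> is blown up to a bipartite family with \<open>N\<close> copies of
  \<open>i\<close> and of \<open>j\<close>, the box condition makes the degrees and codegrees of this family concentrate,
  and one application of Cauchy--Schwarz bounds the correlation. Replacing edges one at a time,
  functions of the subarrays on two disjoint blocks of length \<open>k\<close> are almost uncorrelated.

  If every one of \<open>m = n div k\<close> consecutive blocks violated the conclusion, it would carry a function
  \<open>h\<^sub>l\<close> of its subarray with \<open>\<bar>h\<^sub>l\<bar> \<le> 1\<close> and \<open>E[h\<^sub>l f] \<ge> \<epsilon>\<^sup>2\<close>, so that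
  \<open>S = \<Sum>\<^sub>l (h\<^sub>l - E h\<^sub>l)\<close> would satisfy \<open>E[S f] \<ge> m \<epsilon>\<^sup>2\<close>. But \<open>S\<close> has variance \<open>o(m\<^sup>2)\<close>, whence
  truncating \<open>f\<close> at a height \<open>K\<close> depending only on \<open>\<epsilon>\<close> and \<open>p\<close> gives a contradiction. Since pairwise
  decorrelation of the blocks suffices, \<open>n\<close> only has to beat a power of \<open>K\<close> and \<open>2 ^ (k\<^sup>2)\<close>.
\<close>

section \<open>Quasirandom bipartite families\<close>

text \<open>Spreadability compares only increasing embeddings, so the array need not be
  exchangeable: two edges meeting at their larger vertex and two edges meeting at their smaller
  vertex may have different joint densities. All copies of \<open>i\<close> are therefore placed
  before all copies of \<open>j\<close>; there edges, each kind of cherry and four-cycles have one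
  density up to \<open>\<eta>\<close>. Nonnegativity of second moments then bounds one cherry
  density from below and the other from above. The eighth power in
  \<open>14 * \<eta> + 3 / N \<le> \<tau> ^ 8\<close> pays for three square roots: from the
  four-cycle to the cherry density, from the variance of a degree to its first absolute moment, and
  in the final Cauchy--Schwarz step. In the theorem \<open>\<eta> = exp (- T)\<close> and
  \<open>N\<close> is about \<open>exp T / (2 * k)\<close>, whence
  \<open>\<tau> = exp (k - T / 8)\<close>. Two demands fix the size of \<open>T\<close>:
  \<open>\<tau>\<close> has to beat the number of graphs on a block, whose logarithm is of order
  \<open>k\<^sup>2\<close>, and powers of the truncation height, whose logarithm is estimated by a
  multiple of \<open>1 / (\<epsilon> ^ 8 * (p - 1)\<^sup>2)\<close>.\<close>

lemma prod_of_bool: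
  "finite F \<Longrightarrow> (\<Prod>t\<in>F. of_bool (P t)) = (of_bool (\<forall>t\<in>F. P t) :: real)"
  by (induction F rule: finite_induct) auto

lemma abs_mult_le_one:
  fixes x y :: real
  assumes "\<bar>x\<bar> \<le> 1" "\<bar>y\<bar> \<le> 1"
  shows "\<bar>x * y\<bar> \<le> 1"
  unfolding abs_mult using assms by (intro mult_le_one) auto

lemma abs_combination_le:
  fixes s t x y :: real
  assumes "\<bar>s\<bar> \<le> 1" "\<bar>t\<bar> \<le> 1" "\<bar>x\<bar> \<le> a" "\<bar>y\<bar> \<le> b"
  shows "\<bar>s * x + t * y\<bar> \<le> a + b"
proof -
  have "\<bar>s * x\<bar> \<le> \<bar>x\<bar>" "\<bar>t * y\<bar> \<le> \<bar>y\<bar>"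
    unfolding abs_mult using assms by (auto intro: mult_left_le_one_le)
  thus ?thesis using assms(3,4) by linarith
qed

text \<open>Serves to replace the factors of a nested product one by one, \<open>y\<close> being the
  tail already compared with \<open>Y\<close>. Since \<open>a\<close> and \<open>Y\<close> lie in
  the unit interval, the errors \<alpha> and \<beta> simply add up.\<close>

lemma mult_perturbation:
  fixes a y c Y \<alpha> \<beta> :: real
  assumes "a \<le> c + \<alpha>" "0 \<le> a" "a \<le> 1" "0 \<le> Y" "Y \<le> 1" "0 \<le> \<alpha>" "0 \<le> \<beta>" "y \<le> Y + \<beta>"
  shows "a * y \<le> c * Y + (\<alpha> + \<beta>)"
proof -
  have "a * y \<le> a * (Y + \<beta>)" using assms by (intro mult_left_mono)
  also have "\<dots> = a * Y + a * \<beta>" by (rule distrib_left)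
  also have "\<dots> \<le> (c + \<alpha>) * Y + \<beta>" using assms by (intro add_mono mult_right_mono mult_left_le_one_le)
  also have "\<dots> \<le> c * Y + (\<alpha> + \<beta>)" using mult_left_le[of Y \<alpha>] assms by (simp add: algebra_simps)
  finally show ?thesis .
qed

context prob_space
begin

section \<open>Moment bounds for bounded random variables\<close>

lemma integrable_bounded:
  fixes Y :: "'a \<Rightarrow> real"
  assumes "Y \<in> borel_measurable M" "\<And>\<omega>. \<omega> \<in> space M \<Longrightarrow> \<bar>Y \<omega>\<bar> \<le> K"
  shows "integrable M Y"
  using assms by (intro integrable_const_bound[of Y K]) auto

lemma expectation_abs_le:
  fixes Y :: "'a \<Rightarrow> real"
  assumes "Y \<in> borel_measurable M" "\<And>\<omega>. \<omega> \<in> space M \<Longrightarrow> \<bar>Y \<omega>\<bar> \<le> K"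
  shows "\<bar>expectation Y\<bar> \<le> K"
proof -
  have i: "integrable M Y" using assms by (rule integrable_bounded)
  have "\<bar>expectation Y\<bar> \<le> expectation (\<lambda>\<omega>. \<bar>Y \<omega>\<bar>)" by (rule integral_abs_bound)
  also have "\<dots> \<le> expectation (\<lambda>_. K)"
    using i assms by (intro integral_mono) auto
  finally show ?thesis by (simp add: prob_space)
qed

text \<open>This is nonnegativity of the variance of the absolute value; boundedness supplies
  integrability.\<close>

lemma expectation_abs_sq_le:
  fixes Y :: "'a \<Rightarrow> real"
  assumes "Y \<in> borel_measurable M" "\<And>\<omega>. \<omega> \<in> space M \<Longrightarrow> \<bar>Y \<omega>\<bar> \<le> K"
  shows "(expectation (\<lambda>\<omega>. \<bar>Y \<omega>\<bar>))\<^sup>2 \<le> expectation (\<lambda>\<omega>. (Y \<omega>)\<^sup>2)"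
proof -
  have 1: "integrable M (\<lambda>\<omega>. \<bar>Y \<omega>\<bar>)" using assms by (intro integrable_bounded[of _ K]) auto
  have "\<bar>(Y \<omega>)\<^sup>2\<bar> \<le> K\<^sup>2" if "\<omega> \<in> space M" for \<omega>
    using assms(2)[OF that] power_mono[of "\<bar>Y \<omega>\<bar>" K 2] by simp
  hence 2: "integrable M (\<lambda>\<omega>. (\<bar>Y \<omega>\<bar>)\<^sup>2)" using assms by (intro integrable_bounded[of _ "K\<^sup>2"]) auto
  show ?thesis
    using variance_eq[OF 1 2] variance_positive[of "\<lambda>\<omega>. \<bar>Y \<omega>\<bar>"] by simp
qed

text \<open>Expand the square: the diagonal pairs cost at most \<open>1 / N\<close> altogether, the
  other pairs at most \<open>w\<close>, and the lower bound \<open>e\<close> enters the cross term,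
  whose sign uses \<open>t \<ge> 0\<close>. Because the left side is nonnegative, a good choice of
  the target \<open>t\<close> also yields inequalities between densities.\<close>

lemma average_deviation:
  fixes Y :: "nat \<Rightarrow> 'a \<Rightarrow> real"
  assumes N: "N > 0" and t: "t \<ge> 0" and w: "w \<ge> 0"
    and meas: "\<And>b. b < N \<Longrightarrow> Y b \<in> borel_measurable M"
    and bd: "\<And>b \<omega>. b < N \<Longrightarrow> \<omega> \<in> space M \<Longrightarrow> 0 \<le> Y b \<omega> \<and> Y b \<omega> \<le> 1"
    and e: "\<And>b. b < N \<Longrightarrow> e \<le> expectation (Y b)"
    and corr: "\<And>b b'. b < N \<Longrightarrow> b' < N \<Longrightarrow> b \<noteq> b' \<Longrightarrow> expectation (\<lambda>\<omega>. Y b \<omega> * Y b' \<omega>) \<le> w"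
  shows "expectation (\<lambda>\<omega>. ((\<Sum>b<N. Y b \<omega>) / N - t)\<^sup>2) \<le> w + 1 / N - 2 * t * e + t\<^sup>2"
proof -
  have iY: "integrable M (Y b)" if "b < N" for b
    using meas[OF that] bd[OF that] by (intro integrable_bounded[of _ 1]) auto
  have bYY: "0 \<le> Y b \<omega> * Y b' \<omega> \<and> Y b \<omega> * Y b' \<omega> \<le> 1" if "b < N" "b' < N" "\<omega> \<in> space M" for b b' \<omega>
    using bd that by (auto intro: mult_le_one)
  have iYY: "integrable M (\<lambda>\<omega>. Y b \<omega> * Y b' \<omega>)" if "b < N" "b' < N" for b b'
    using meas that bYY[OF that] by (intro integrable_bounded[of _ 1]) auto
  have YY: "expectation (\<lambda>\<omega>. Y b \<omega> * Y b' \<omega>) \<le> w + (if b = b' then 1 else 0)"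
    if "b < N" "b' < N" for b b'
  proof (cases "b = b'")
    case True
    have "expectation (\<lambda>\<omega>. Y b \<omega> * Y b' \<omega>) \<le> expectation (\<lambda>_. 1)"
      using iYY[OF that] bYY[OF that] by (intro integral_mono) auto
    thus ?thesis using True w by (simp add: prob_space)
  qed (use corr[OF that] in simp)
  have "expectation (\<lambda>\<omega>. ((\<Sum>b<N. Y b \<omega>) / N - t)\<^sup>2)
      = expectation (\<lambda>\<omega>. (\<Sum>b<N. \<Sum>b'<N. Y b \<omega> * Y b' \<omega>) / N^2 - (2 * t / N) * (\<Sum>b<N. Y b \<omega>) + t\<^sup>2)"
    using N by (intro Bochner_Integration.integral_cong refl)
      (simp add: power2_diff power_divide power2_eq_square algebra_simps flip: sum_product)
  also have "\<dots> = (\<Sum>b<N. \<Sum>b'<N. expectation (\<lambda>\<omega>. Y b \<omega> * Y b' \<omega>)) / N^2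
      - (2 * t / N) * (\<Sum>b<N. expectation (Y b)) + t\<^sup>2"
  proof -
    have i: "integrable M (\<lambda>\<omega>. \<Sum>b<N. Y b \<omega>)" "integrable M (\<lambda>\<omega>. \<Sum>b<N. \<Sum>b'<N. Y b \<omega> * Y b' \<omega>)"
      "\<And>b. b < N \<Longrightarrow> integrable M (\<lambda>\<omega>. \<Sum>b'<N. Y b \<omega> * Y b' \<omega>)"
      using iY iYY by (auto intro!: Bochner_Integration.integrable_sum)
    have "expectation (\<lambda>\<omega>. \<Sum>b<N. \<Sum>b'<N. Y b \<omega> * Y b' \<omega>) = (\<Sum>b<N. \<Sum>b'<N. expectation (\<lambda>\<omega>. Y b \<omega> * Y b' \<omega>))"
      using i iYY by (simp add: Bochner_Integration.integral_sum)
    moreover have "expectation (\<lambda>\<omega>. \<Sum>b<N. Y b \<omega>) = (\<Sum>b<N. expectation (Y b))"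
      using iY by (simp add: Bochner_Integration.integral_sum)
    ultimately show ?thesis using i
      by (simp add: prob_space)
  qed
  also have "\<dots> \<le> (\<Sum>b<N. \<Sum>b'<N. w + (if b = b' then 1 else 0)) / N^2 - (2 * t / N) * (\<Sum>b<N. e) + t\<^sup>2"
    using t e YY by (intro add_mono diff_mono divide_right_mono sum_mono mult_left_mono) auto
  also have "\<dots> = w + 1 / N - 2 * t * e + t\<^sup>2"
    using N by (simp add: sum.distrib power2_eq_square add_divide_distrib)
  finally show ?thesis .
qed

text \<open>Here \<open>rL\<close>, \<open>rR\<close> are the densities of the cherries with two left and two right vertices,
  and \<open>q\<close> that of the four-cycle, which is at least \<open>p ^ 4\<close> up to the error and hence extremal.
  The proof bounds the variances of the degrees \<open>\<delta>\<close> and codegrees \<open>c\<close> of left vertices.\<close>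

lemma quasirandom_decorrelation:
  fixes D :: "nat \<Rightarrow> nat \<Rightarrow> 'a \<Rightarrow> real" and U V :: "nat \<Rightarrow> 'a \<Rightarrow> real"
  assumes N: "N > 0" and range: "0 \<le> p" "p \<le> 1" "0 \<le> rL" "rL \<le> 1" "0 \<le> rR" "rR \<le> 1" "0 \<le> q" "0 \<le> \<eta>"
    and Dm: "\<And>a b. a < N \<Longrightarrow> b < N \<Longrightarrow> D a b \<in> borel_measurable M"
    and Db: "\<And>a b \<omega>. a < N \<Longrightarrow> b < N \<Longrightarrow> \<omega> \<in> space M \<Longrightarrow> 0 \<le> D a b \<omega> \<and> D a b \<omega> \<le> 1"
    and D1: "\<And>a b. a < N \<Longrightarrow> b < N \<Longrightarrow> \<bar>expectation (D a b) - p\<bar> \<le> \<eta>"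
    and DL: "\<And>a a' b. a < N \<Longrightarrow> a' < N \<Longrightarrow> b < N \<Longrightarrow> a \<noteq> a' \<Longrightarrow>
        \<bar>expectation (\<lambda>\<omega>. D a b \<omega> * D a' b \<omega>) - rL\<bar> \<le> \<eta>"
    and DR: "\<And>a b b'. a < N \<Longrightarrow> b < N \<Longrightarrow> b' < N \<Longrightarrow> b \<noteq> b' \<Longrightarrow>
        \<bar>expectation (\<lambda>\<omega>. D a b \<omega> * D a b' \<omega>) - rR\<bar> \<le> \<eta>"
    and DC: "\<And>a a' b b'. a < N \<Longrightarrow> a' < N \<Longrightarrow> b < N \<Longrightarrow> b' < N \<Longrightarrow> a \<noteq> a' \<Longrightarrow> b \<noteq> b' \<Longrightarrow>
        \<bar>expectation (\<lambda>\<omega>. (D a b \<omega> * D a' b \<omega>) * (D a b' \<omega> * D a' b' \<omega>)) - q\<bar> \<le> \<eta>"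
    and q: "q \<le> p ^ 4 + 5 * \<eta>"
    and \<tau>: "0 < \<tau>" "\<tau> \<le> 1" "14 * \<eta> + 3 / N \<le> \<tau> ^ 8"
    and Um: "\<And>a. a < N \<Longrightarrow> U a \<in> borel_measurable M" and Ub: "\<And>a \<omega>. \<bar>U a \<omega>\<bar> \<le> 1"
    and Vm: "\<And>b. b < N \<Longrightarrow> V b \<in> borel_measurable M" and Vb: "\<And>b \<omega>. \<bar>V b \<omega>\<bar> \<le> 1"
  shows "\<bar>\<Sum>a<N. \<Sum>b<N. expectation (\<lambda>\<omega>. (D a b \<omega> - p) * U a \<omega> * V b \<omega>)\<bar> \<le> (9 / 4) * \<tau> * (real N)^2"
proof -
  define \<delta> where "\<delta> = (\<lambda>a \<omega>. (\<Sum>b<N. D a b \<omega>) / N)"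
  define c where "c = (\<lambda>a a' \<omega>. (\<Sum>b<N. D a b \<omega> * D a' b \<omega>) / N)"
  have Nr: "real N > 0" using N by simp
  have prod: "0 \<le> D a b \<omega> * D a' b' \<omega> \<and> D a b \<omega> * D a' b' \<omega> \<le> 1"
    if "a < N" "b < N" "a' < N" "b' < N" "\<omega> \<in> space M" for a b a' b' \<omega>
    using Db that by (auto intro: mult_le_one)
  have \<delta>dev: "expectation (\<lambda>\<omega>. (\<delta> a \<omega> - p)\<^sup>2) \<le> (rR + \<eta>) + 1 / N - 2 * p * (p - \<eta>) + p\<^sup>2" if "a < N" for a
    unfolding \<delta>_def
  proof (rule average_deviation[OF N])
    show "p - \<eta> \<le> expectation (D a b)" if "b < N" for b
      using D1[OF \<open>a < N\<close> that] by linarith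
    show "expectation (\<lambda>\<omega>. D a b \<omega> * D a b' \<omega>) \<le> rR + \<eta>" if "b < N" "b' < N" "b \<noteq> b'" for b b'
      using DR[OF \<open>a < N\<close> that] by linarith
  qed (use that Dm Db range in simp_all)
  have \<delta>dev': "expectation (\<lambda>\<omega>. ((\<Sum>a<N. D a b \<omega>) / N - p)\<^sup>2) \<le> (rL + \<eta>) + 1 / N - 2 * p * (p - \<eta>) + p\<^sup>2" if "b < N" for b
  proof (rule average_deviation[OF N])
    show "p - \<eta> \<le> expectation (D a b)" if "a < N" for a
      using D1[OF that \<open>b < N\<close>] by linarith
    show "expectation (\<lambda>\<omega>. D a b \<omega> * D a' b \<omega>) \<le> rL + \<eta>" if "a < N" "a' < N" "a \<noteq> a'" for a a'
      using DL[OF that(1,2) \<open>b < N\<close> that(3)] by linarith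
  qed (use that Dm Db range in simp_all)
  have cdev: "expectation (\<lambda>\<omega>. (c a a' \<omega> - t)\<^sup>2) \<le> (q + \<eta>) + 1 / N - 2 * t * (rL - \<eta>) + t\<^sup>2"
    if "a < N" "a' < N" "a \<noteq> a'" "t \<ge> 0" for a a' t
    unfolding c_def
  proof (rule average_deviation[OF N that(4)])
    show "rL - \<eta> \<le> expectation (\<lambda>\<omega>. D a b \<omega> * D a' b \<omega>)" if "b < N" for b
      using DL[OF \<open>a < N\<close> \<open>a' < N\<close> that \<open>a \<noteq> a'\<close>] by auto
    show "expectation (\<lambda>\<omega>. D a b \<omega> * D a' b \<omega> * (D a b' \<omega> * D a' b' \<omega>)) \<le> q + \<eta>"
      if "b < N" "b' < N" "b \<noteq> b'" for b b'
      using DC[OF \<open>a < N\<close> \<open>a' < N\<close> that(1,2) \<open>a \<noteq> a'\<close> that(3)] by auto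
  qed (use that Dm prod range in simp_all)
  have cdev': "expectation (\<lambda>\<omega>. ((\<Sum>a<N. D a b \<omega> * D a b' \<omega>) / N - t)\<^sup>2) \<le> (q + \<eta>) + 1 / N - 2 * t * (rR - \<eta>) + t\<^sup>2"
    if "b < N" "b' < N" "b \<noteq> b'" "t \<ge> 0" for b b' t
  proof (rule average_deviation[OF N that(4)])
    show "rR - \<eta> \<le> expectation (\<lambda>\<omega>. D a b \<omega> * D a b' \<omega>)" if "a < N" for a
      using DR[OF that \<open>b < N\<close> \<open>b' < N\<close> \<open>b \<noteq> b'\<close>] by auto
    show "expectation (\<lambda>\<omega>. D a b \<omega> * D a b' \<omega> * (D a' b \<omega> * D a' b' \<omega>)) \<le> q + \<eta>"
      if "a < N" "a' < N" "a \<noteq> a'" for a a'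
      using DC[OF that(1,2) \<open>b < N\<close> \<open>b' < N\<close> that(3) \<open>b \<noteq> b'\<close>] by (auto simp: mult_ac)
  qed (use that Dm prod range in simp_all)
  have nn: "0 \<le> expectation (\<lambda>\<omega>. (Y \<omega>)\<^sup>2)" for Y :: "'a \<Rightarrow> real" by simp
  have \<tau>le: "\<tau> ^ 8 \<le> \<tau> ^ 4" "\<tau> ^ 4 \<le> \<tau>\<^sup>2" "\<tau> ^ 8 \<le> \<tau>\<^sup>2"
    using \<tau> by (auto intro!: power_decreasing)
  have Nt: "1 / N \<le> \<tau> ^ 8" "3 * \<eta> + 1 / N \<le> \<tau> ^ 8" "8 * \<eta> + 1 / N \<le> \<tau> ^ 8"
  proof -
    have "3 / real N = 3 * (1 / N)" "1 / real N > 0" using Nr by auto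
    thus "1 / N \<le> \<tau> ^ 8" "3 * \<eta> + 1 / N \<le> \<tau> ^ 8" "8 * \<eta> + 1 / N \<le> \<tau> ^ 8"
      using \<tau>(3) \<open>0 \<le> \<eta>\<close> by linarith+
  qed
  show ?thesis
  \<comment> \<open>With \<open>N = 1\<close> there are no two distinct copies to compare; this case
    contradicts \<open>14 * \<eta> + 3 / N \<le> \<tau> ^ 8\<close>, whose right side is at most
    1.\<close>
  proof (cases "N = 1")
    case True
    hence "\<tau> ^ 8 \<ge> 3" using \<tau>(3) range by auto
    moreover have "\<tau> ^ 8 \<le> 1" using \<tau> by (simp add: power_le_one)
    ultimately show ?thesis by simp
  next
    case False
    hence N2: "0 < N" "1 < N" using N by auto
    have p2: "p * \<eta> \<le> \<eta>" using range by (simp add: mult_left_le_one_le)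
    \<comment> \<open>The degrees of right vertices have nonnegative second moment about
      \<open>p\<close>, which is \<open>rL - p\<^sup>2\<close> up to errors.\<close>
    have rL_ge: "p\<^sup>2 \<le> rL + 3 * \<eta> + 1 / N"
      using order_trans[OF nn \<delta>dev'[OF N2(1)]] p2 by (simp add: power2_eq_square algebra_simps)
    \<comment> \<open>Codegrees of right vertices about the target \<open>rR\<close>: their second
      moment is at most \<open>q - rR\<^sup>2\<close> up to errors, so the four-cycle bound caps
      \<open>rR\<close>.\<close>
    have "rR * \<eta> \<le> \<eta>" using range by (simp add: mult_left_le_one_le)
    hence "rR\<^sup>2 \<le> p ^ 4 + \<tau> ^ 8"
      using order_trans[OF nn cdev'[OF N2, of rR]] q Nt range by (simp add: power2_eq_square algebra_simps)
    also have "\<dots> \<le> (p\<^sup>2 + \<tau> ^ 4)\<^sup>2"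
    proof -
      have "(p\<^sup>2 + \<tau> ^ 4)\<^sup>2 = p ^ 4 + \<tau> ^ 8 + 2 * (p\<^sup>2 * \<tau> ^ 4)"
        by (simp add: power2_sum flip: power_mult)
      moreover have "p\<^sup>2 * \<tau> ^ 4 \<ge> 0" by simp
      ultimately show ?thesis by linarith
    qed
    finally have rR_le: "rR \<le> p\<^sup>2 + \<tau> ^ 4" using power2_le_imp_le \<tau> range by auto
    have \<delta>m: "\<delta> a \<in> borel_measurable M" if "a < N" for a
      unfolding \<delta>_def using that Dm by (intro borel_measurable_divide borel_measurable_sum) auto
    have cm: "c a a' \<in> borel_measurable M" if "a < N" "a' < N" for a a'
      unfolding c_def using that Dm by (intro borel_measurable_divide borel_measurable_sum borel_measurable_times) auto
    have \<delta>b: "0 \<le> \<delta> a \<omega> \<and> \<delta> a \<omega> \<le> 1" if "a < N" "\<omega> \<in> space M" for a \<omega>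
      unfolding \<delta>_def using that Db Nr sum_bounded_above[of "{..<N}" "\<lambda>b. D a b \<omega>" 1]
      by (auto intro!: divide_nonneg_nonneg sum_nonneg)
    have cb: "0 \<le> c a a' \<omega> \<and> c a a' \<omega> \<le> 1" if "a < N" "a' < N" "\<omega> \<in> space M" for a a' \<omega>
      unfolding c_def using that prod Nr sum_bounded_above[of "{..<N}" "\<lambda>b. D a b \<omega> * D a' b \<omega>" 1]
      by (auto intro!: divide_nonneg_nonneg sum_nonneg)
    have \<delta>b2: "\<bar>\<delta> a \<omega> - p\<bar> \<le> 1" if "a < N" "\<omega> \<in> space M" for a \<omega>
      using \<delta>b[OF that] range by auto
    have pp: "p\<^sup>2 \<le> 1" using range by (simp add: power_le_one)
    have cb2: "\<bar>c a a' \<omega> - p\<^sup>2\<bar> \<le> 1" if "a < N" "a' < N" "\<omega> \<in> space M" for a a' \<omega>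
      using cb[OF that] range pp zero_le_power2[of p] by linarith
    \<comment> \<open>The variance is at most \<open>2 * \<tau> ^ 4\<close>, one half from
      \<open>rR_le\<close> and one from the error terms; \<open>3 / 2\<close> is a rational above
      the square root of 2.\<close>
    have \<delta>1: "expectation (\<lambda>\<omega>. \<bar>\<delta> a \<omega> - p\<bar>) \<le> (3 / 2) * \<tau>\<^sup>2" if a: "a < N" for a
    proof (rule power2_le_imp_le)
      have "(expectation (\<lambda>\<omega>. \<bar>\<delta> a \<omega> - p\<bar>))\<^sup>2 \<le> expectation (\<lambda>\<omega>. (\<delta> a \<omega> - p)\<^sup>2)"
        using \<delta>m a \<delta>b2 by (intro expectation_abs_sq_le[of _ 1]) auto
      also have "\<dots> \<le> 2 * \<tau> ^ 4"
        using \<delta>dev[OF a] rR_le Nt(2) \<tau>le(1) p2 by (simp add: power2_eq_square algebra_simps)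
      also have "\<dots> \<le> ((3 / 2) * \<tau>\<^sup>2)\<^sup>2"
        using \<tau>(1) by (simp add: power_mult_distrib power_divide)
      finally show "(expectation (\<lambda>\<omega>. \<bar>\<delta> a \<omega> - p\<bar>))\<^sup>2 \<le> ((3 / 2) * \<tau>\<^sup>2)\<^sup>2" .
    qed simp
    \<comment> \<open>With target \<open>p\<^sup>2\<close> the main terms are
      \<open>q - 2 * p\<^sup>2 * rL + p ^ 4\<close>; the bounds \<open>q\<close> and
      \<open>rL_ge\<close> leave nothing but errors of them.\<close>
    have c1: "expectation (\<lambda>\<omega>. \<bar>c a a' \<omega> - p\<^sup>2\<bar>) \<le> \<tau>\<^sup>2" if a: "a < N" "a' < N" "a \<noteq> a'" for a a'
    proof (rule power2_le_imp_le)
      have "(expectation (\<lambda>\<omega>. \<bar>c a a' \<omega> - p\<^sup>2\<bar>))\<^sup>2 \<le> expectation (\<lambda>\<omega>. (c a a' \<omega> - p\<^sup>2)\<^sup>2)"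
        using cm a cb2 by (intro expectation_abs_sq_le[of _ 1]) auto
      also have "\<dots> \<le> (q + \<eta>) + 1 / N - 2 * p\<^sup>2 * (rL - \<eta>) + (p\<^sup>2)\<^sup>2"
        using cdev[OF a, of "p\<^sup>2"] by simp
      also have "\<dots> \<le> (p ^ 4 + 5 * \<eta> + \<eta>) + 1 / N - 2 * p\<^sup>2 * (p\<^sup>2 - 4 * \<eta> - 1 / N) + (p\<^sup>2)\<^sup>2"
      proof -
        have "p\<^sup>2 - 4 * \<eta> - 1 / N \<le> rL - \<eta>" using rL_ge by linarith
        hence "2 * p\<^sup>2 * (p\<^sup>2 - 4 * \<eta> - 1 / N) \<le> 2 * p\<^sup>2 * (rL - \<eta>)" by (rule mult_left_mono) simp
        thus ?thesis using q by linarith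
      qed
      also have "\<dots> = 6 * \<eta> + 1 / N + p\<^sup>2 * (8 * \<eta> + 2 / N)"
        by (simp add: algebra_simps power2_eq_square numeral_eq_Suc)
      also have "\<dots> \<le> 6 * \<eta> + 1 / N + (8 * \<eta> + 2 / N)"
        using pp range Nr by (intro add_mono mult_left_le_one_le) auto
      also have "\<dots> = 14 * \<eta> + 3 / N" by (simp add: field_simps)
      also have "\<dots> \<le> \<tau> ^ 4" using \<tau>(3) \<tau>le(1) by linarith
      finally show "(expectation (\<lambda>\<omega>. \<bar>c a a' \<omega> - p\<^sup>2\<bar>))\<^sup>2 \<le> (\<tau>\<^sup>2)\<^sup>2" by simp
    qed simp
    \<comment> \<open>The Gram matrix of the centred rows of \<open>D\<close>. Its off-diagonal
      entries are small because degrees and codegrees concentrate.\<close>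
    define d where "d = (\<lambda>a a' \<omega>. \<Sum>b<N. (D a b \<omega> - p) * (D a' b \<omega> - p))"
    have d_eq: "d a a' \<omega> = N * ((c a a' \<omega> - p\<^sup>2) - p * (\<delta> a \<omega> - p) - p * (\<delta> a' \<omega> - p))" for a a' \<omega>
      using Nr unfolding d_def c_def \<delta>_def
      by (simp add: field_simps sum.distrib sum_subtractf power2_eq_square flip: sum_distrib_left)
    have d_abs: "\<bar>d a a' \<omega>\<bar> \<le> N * (\<bar>c a a' \<omega> - p\<^sup>2\<bar> + \<bar>\<delta> a \<omega> - p\<bar> + \<bar>\<delta> a' \<omega> - p\<bar>)" for a a' \<omega>
    proof -
      have "\<bar>p * x\<bar> \<le> \<bar>x\<bar>" for x using range by (simp add: abs_mult mult_left_le_one_le)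
      from this[of "\<delta> a \<omega> - p"] this[of "\<delta> a' \<omega> - p"] have
        "\<bar>(c a a' \<omega> - p\<^sup>2) - p * (\<delta> a \<omega> - p) - p * (\<delta> a' \<omega> - p)\<bar>
          \<le> \<bar>c a a' \<omega> - p\<^sup>2\<bar> + \<bar>\<delta> a \<omega> - p\<bar> + \<bar>\<delta> a' \<omega> - p\<bar>"
        by linarith
      thus ?thesis unfolding d_eq abs_mult by (simp add: mult_left_mono)
    qed
    have dm: "d a a' \<in> borel_measurable M" if "a < N" "a' < N" for a a'
      unfolding d_def using that Dm by (intro borel_measurable_sum borel_measurable_times borel_measurable_diff) auto
    have db: "\<bar>d a a' \<omega>\<bar> \<le> N" if "a < N" "a' < N" "\<omega> \<in> space M" for a a' \<omega>
    proof -
      have "\<bar>(D a b \<omega> - p) * (D a' b \<omega> - p)\<bar> \<le> 1" if "b < N" for b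
        using Db[of a b \<omega>] Db[of a' b \<omega>] \<open>a < N\<close> \<open>a' < N\<close> \<open>\<omega> \<in> space M\<close> that range
        unfolding abs_mult by (intro mult_le_one) auto
      hence "(\<Sum>b<N. \<bar>(D a b \<omega> - p) * (D a' b \<omega> - p)\<bar>) \<le> N"
        using sum_bounded_above[of "{..<N}" "\<lambda>b. \<bar>(D a b \<omega> - p) * (D a' b \<omega> - p)\<bar>" 1] by auto
      thus ?thesis unfolding d_def by (rule order_trans[OF sum_abs])
    qed
    have di: "integrable M (\<lambda>\<omega>. \<bar>d a a' \<omega>\<bar>)" if "a < N" "a' < N" for a a'
      using dm db that by (intro integrable_bounded[of _ N]) auto
    \<comment> \<open>Here 4 is 1 from the codegree plus twice \<open>3 / 2\<close> from the two
      degrees; the diagonal gets the trivial bound \<open>N\<close>.\<close>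
    have Ed: "expectation (\<lambda>\<omega>. \<bar>d a a' \<omega>\<bar>) \<le> 4 * N * \<tau>\<^sup>2 + (if a = a' then real N else 0)"
      if a: "a < N" "a' < N" for a a'
    proof (cases "a = a'")
      case True
      have "expectation (\<lambda>\<omega>. \<bar>d a a' \<omega>\<bar>) \<le> N"
        using expectation_abs_le[of "\<lambda>\<omega>. \<bar>d a a' \<omega>\<bar>" N] dm[OF a] db[OF a] by auto
      thus ?thesis using True by (simp add: add_increasing)
    next
      case False
      have i: "integrable M (\<lambda>\<omega>. \<bar>c a a' \<omega> - p\<^sup>2\<bar>)" "integrable M (\<lambda>\<omega>. \<bar>\<delta> a \<omega> - p\<bar>)" "integrable M (\<lambda>\<omega>. \<bar>\<delta> a' \<omega> - p\<bar>)"
        using cm \<delta>m a cb2 \<delta>b2 by (auto intro!: integrable_bounded[of _ 1])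
      have "expectation (\<lambda>\<omega>. \<bar>d a a' \<omega>\<bar>) \<le> expectation (\<lambda>\<omega>. N * (\<bar>c a a' \<omega> - p\<^sup>2\<bar> + \<bar>\<delta> a \<omega> - p\<bar> + \<bar>\<delta> a' \<omega> - p\<bar>))"
        using i d_abs di[OF a] by (intro integral_mono) auto
      also have "\<dots> = N * (expectation (\<lambda>\<omega>. \<bar>c a a' \<omega> - p\<^sup>2\<bar>) + expectation (\<lambda>\<omega>. \<bar>\<delta> a \<omega> - p\<bar>) + expectation (\<lambda>\<omega>. \<bar>\<delta> a' \<omega> - p\<bar>))"
        using i by simp
      also have "\<dots> \<le> N * (4 * \<tau>\<^sup>2)"
        using c1[OF a False] \<delta>1[OF a(1)] \<delta>1[OF a(2)] by (intro mult_left_mono) auto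
      finally show ?thesis using False by simp
    qed
    \<comment> \<open>Cauchy--Schwarz over \<open>b\<close> removes \<open>V\<close>; summing
      \<open>G\<^sup>2\<close> over \<open>b\<close> then produces the Gram matrix \<open>d\<close>,
      and \<open>U\<close> disappears by its bound 1.\<close>
    define G where "G = (\<lambda>b \<omega>. \<Sum>a<N. (D a b \<omega> - p) * U a \<omega>)"
    have Gm: "G b \<in> borel_measurable M" if "b < N" for b
      unfolding G_def using that Dm Um by (intro borel_measurable_sum borel_measurable_times borel_measurable_diff) auto
    have term_b: "\<bar>(D a b \<omega> - p) * U a \<omega>\<bar> \<le> 1" if "a < N" "b < N" "\<omega> \<in> space M" for a b \<omega>
      using Db[OF that] Ub[of a \<omega>] range unfolding abs_mult by (intro mult_le_one) auto
    have Gb: "\<bar>G b \<omega>\<bar> \<le> N" if "b < N" "\<omega> \<in> space M" for b \<omega>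
    proof -
      have "(\<Sum>a<N. \<bar>(D a b \<omega> - p) * U a \<omega>\<bar>) \<le> N"
        using sum_bounded_above[of "{..<N}" "\<lambda>a. \<bar>(D a b \<omega> - p) * U a \<omega>\<bar>" 1] term_b that by auto
      thus ?thesis unfolding G_def by (rule order_trans[OF sum_abs])
    qed
    have GiI: "integrable M (\<lambda>\<omega>. \<bar>G b \<omega>\<bar>)" if "b < N" for b
      using Gm Gb that by (intro integrable_bounded[of _ N]) auto
    have "\<bar>(G b \<omega>)\<^sup>2\<bar> \<le> (real N)\<^sup>2" if "b < N" "\<omega> \<in> space M" for b \<omega>
      using Gb[OF that] power_mono[of "\<bar>G b \<omega>\<bar>" "real N" 2] by simp
    hence G2i: "integrable M (\<lambda>\<omega>. (G b \<omega>)\<^sup>2)" if "b < N" for b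
      using Gm that by (intro integrable_bounded[of _ "(real N)\<^sup>2"]) auto
    have G2: "(\<Sum>b<N. (G b \<omega>)\<^sup>2) \<le> (\<Sum>a<N. \<Sum>a'<N. \<bar>d a a' \<omega>\<bar>)" for \<omega>
    proof -
      have "(\<Sum>b<N. (G b \<omega>)\<^sup>2) = (\<Sum>b<N. \<Sum>a<N. \<Sum>a'<N. ((D a b \<omega> - p) * (D a' b \<omega> - p)) * (U a \<omega> * U a' \<omega>))"
        unfolding G_def power2_eq_square sum_product by (simp add: mult_ac)
      also have "\<dots> = (\<Sum>a<N. \<Sum>a'<N. d a a' \<omega> * (U a \<omega> * U a' \<omega>))"
        unfolding d_def sum_distrib_right
        by (rule trans[OF sum.swap]) (rule sum.cong[OF refl], rule sum.swap)
      also have "\<dots> \<le> (\<Sum>a<N. \<Sum>a'<N. \<bar>d a a' \<omega>\<bar>)"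
      proof (intro sum_mono)
        fix a a'
        have "\<bar>U a \<omega> * U a' \<omega>\<bar> \<le> 1" unfolding abs_mult using Ub by (intro mult_le_one) auto
        hence "\<bar>d a a' \<omega> * (U a \<omega> * U a' \<omega>)\<bar> \<le> \<bar>d a a' \<omega>\<bar>"
          unfolding abs_mult[of "d a a' \<omega>"] by (rule mult_left_le) simp
        thus "d a a' \<omega> * (U a \<omega> * U a' \<omega>) \<le> \<bar>d a a' \<omega>\<bar>" by linarith
      qed
      finally show ?thesis .
    qed
    have "expectation (\<lambda>\<omega>. \<Sum>b<N. (G b \<omega>)\<^sup>2) \<le> expectation (\<lambda>\<omega>. \<Sum>a<N. \<Sum>a'<N. \<bar>d a a' \<omega>\<bar>)"
      using G2 G2i di by (intro integral_mono) (auto intro!: Bochner_Integration.integrable_sum)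
    also have "\<dots> = (\<Sum>a<N. \<Sum>a'<N. expectation (\<lambda>\<omega>. \<bar>d a a' \<omega>\<bar>))"
    proof -
      have "integrable M (\<lambda>\<omega>. \<Sum>a'<N. \<bar>d a a' \<omega>\<bar>)" if "a < N" for a
        using di that by (auto intro!: Bochner_Integration.integrable_sum)
      thus ?thesis using di by (simp add: Bochner_Integration.integral_sum)
    qed
    also have "\<dots> \<le> (\<Sum>a<N. \<Sum>a'<N. 4 * N * \<tau>\<^sup>2 + (if a = a' then real N else 0))"
      using Ed by (intro sum_mono) auto
    also have "\<dots> = 4 * N^3 * \<tau>\<^sup>2 + N^3 * (1 / N)"
      using Nr by (simp add: sum.distrib power2_eq_square power3_eq_cube algebra_simps)
    also have "\<dots> \<le> 4 * N^3 * \<tau>\<^sup>2 + N^3 * \<tau>\<^sup>2"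
      using Nt(1) \<tau>le(3) by (intro add_mono mult_left_mono) auto
    finally have EG2: "(\<Sum>b<N. expectation (\<lambda>\<omega>. (G b \<omega>)\<^sup>2)) \<le> 5 * N^3 * \<tau>\<^sup>2"
      using G2i by (simp add: Bochner_Integration.integral_sum algebra_simps)
    \<comment> \<open>Cauchy--Schwarz in the form of a weighted AM-GM inequality. The best weight
      would be the square root of 5 times \<open>\<tau> * N\<close>; the rational
      \<open>5 / 2\<close> gives \<open>1 + 5 / 4 = 9 / 4\<close>.\<close>
    define l where "l = (5 / 2) * \<tau> * N"
    have l: "l > 0" unfolding l_def using \<tau> Nr by simp
    have amgm: "\<bar>x\<bar> \<le> x\<^sup>2 / (2 * l) + l / 2" for x :: real
    proof -
      have "0 \<le> (\<bar>x\<bar> - l)\<^sup>2" by simp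
      hence "2 * l * \<bar>x\<bar> \<le> x\<^sup>2 + l\<^sup>2" by (simp add: power2_diff mult_ac)
      thus ?thesis using l by (simp add: field_simps power2_eq_square)
    qed
    have EG: "expectation (\<lambda>\<omega>. \<bar>G b \<omega>\<bar>) \<le> expectation (\<lambda>\<omega>. (G b \<omega>)\<^sup>2) / (2 * l) + l / 2" if "b < N" for b
    proof -
      have "expectation (\<lambda>\<omega>. \<bar>G b \<omega>\<bar>) \<le> expectation (\<lambda>\<omega>. (G b \<omega>)\<^sup>2 / (2 * l) + l / 2)"
        using GiI G2i that amgm by (intro integral_mono) auto
      thus ?thesis using G2i that by (simp add: prob_space)
    qed
    have inner: "(\<Sum>a<N. expectation (\<lambda>\<omega>. (D a b \<omega> - p) * U a \<omega> * V b \<omega>)) = expectation (\<lambda>\<omega>. G b \<omega> * V b \<omega>)"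
      if b: "b < N" for b
    proof -
      have "integrable M (\<lambda>\<omega>. (D a b \<omega> - p) * U a \<omega> * V b \<omega>)" if "a < N" for a
      proof (rule integrable_bounded[of _ 1])
        show "(\<lambda>\<omega>. (D a b \<omega> - p) * U a \<omega> * V b \<omega>) \<in> borel_measurable M"
          using Dm Um Vm b that by (intro borel_measurable_times borel_measurable_diff) auto
        show "\<bar>(D a b \<omega> - p) * U a \<omega> * V b \<omega>\<bar> \<le> 1" if "\<omega> \<in> space M" for \<omega>
          using term_b[OF \<open>a < N\<close> b that] Vb[of b \<omega>]
          unfolding abs_mult[of _ "V b \<omega>"] by (intro mult_le_one) auto
      qed
      thus ?thesis unfolding G_def sum_distrib_right by (simp add: Bochner_Integration.integral_sum)
    qed
    have inner_abs: "\<bar>expectation (\<lambda>\<omega>. G b \<omega> * V b \<omega>)\<bar> \<le> expectation (\<lambda>\<omega>. \<bar>G b \<omega>\<bar>)" if b: "b < N" for b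
    proof -
      have le: "\<bar>G b \<omega> * V b \<omega>\<bar> \<le> \<bar>G b \<omega>\<bar>" for \<omega>
        unfolding abs_mult using Vb by (intro mult_left_le) auto
      have "integrable M (\<lambda>\<omega>. G b \<omega> * V b \<omega>)"
        using Gm[OF b] Vm[OF b] order_trans[OF le Gb[OF b]] by (intro integrable_bounded[of _ N]) auto
      hence "expectation (\<lambda>\<omega>. \<bar>G b \<omega> * V b \<omega>\<bar>) \<le> expectation (\<lambda>\<omega>. \<bar>G b \<omega>\<bar>)"
        using GiI[OF b] le by (intro integral_mono) auto
      thus ?thesis by (rule order_trans[OF integral_abs_bound])
    qed
    have "\<bar>\<Sum>a<N. \<Sum>b<N. expectation (\<lambda>\<omega>. (D a b \<omega> - p) * U a \<omega> * V b \<omega>)\<bar>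
        = \<bar>\<Sum>b<N. expectation (\<lambda>\<omega>. G b \<omega> * V b \<omega>)\<bar>"
      by (subst sum.swap) (simp add: inner)
    also have "\<dots> \<le> (\<Sum>b<N. expectation (\<lambda>\<omega>. (G b \<omega>)\<^sup>2) / (2 * l) + l / 2)"
      by (intro order_trans[OF sum_abs sum_mono] order_trans[OF inner_abs EG]) auto
    also have "\<dots> = (\<Sum>b<N. expectation (\<lambda>\<omega>. (G b \<omega>)\<^sup>2)) / (2 * l) + N * l / 2"
      by (simp add: sum.distrib sum_divide_distrib)
    also have "\<dots> \<le> 5 * N^3 * \<tau>\<^sup>2 / (2 * l) + N * l / 2"
      using EG2 l by (intro add_mono divide_right_mono) auto
    also have "\<dots> = (9 / 4) * \<tau> * (real N)^2"
      unfolding l_def using \<tau>(1) Nr by (simp add: field_simps power2_eq_square power3_eq_cube)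
    finally show ?thesis .
  qed
qed

lemma expectation_unit_interval:
  assumes "Y \<in> borel_measurable M" "\<And>\<omega>. \<omega> \<in> space M \<Longrightarrow> 0 \<le> Y \<omega> \<and> Y \<omega> \<le> (1::real)"
  shows "0 \<le> expectation Y \<and> expectation Y \<le> 1"
  using expectation_abs_le[of Y 1] assms by (auto intro!: integral_nonneg_AE)

text \<open>A substitute for Hoelder's inequality: \<open>F\<close> is cut off at height \<open>K\<close>, so that only the first
  absolute moment of \<open>S\<close> is needed.\<close>

lemma truncated_duality:
  fixes F S :: "'a \<Rightarrow> real"
  assumes p: "1 < p" and K: "0 < K"
    and F: "F \<in> borel_measurable M" "\<And>\<omega>. \<omega> \<in> space M \<Longrightarrow> \<bar>F \<omega>\<bar> \<le> B" "expectation (\<lambda>\<omega>. \<bar>F \<omega>\<bar> powr p) = 1"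
    and S: "S \<in> borel_measurable M" "\<And>\<omega>. \<bar>S \<omega>\<bar> \<le> L"
  shows "expectation (\<lambda>\<omega>. S \<omega> * F \<omega>) \<le> K * expectation (\<lambda>\<omega>. \<bar>S \<omega>\<bar>) + L * K powr (1 - p)"
proof -
  have L: "L \<ge> 0" using S(2)[of undefined] by linarith
  have "\<bar>F \<omega>\<bar> powr p \<le> B powr p" if "\<omega> \<in> space M" for \<omega>
    using F(2)[OF that] p by (intro powr_mono2) auto
  hence iF: "integrable M (\<lambda>\<omega>. \<bar>F \<omega>\<bar> powr p)"
    using F(1) by (intro integrable_bounded[of _ "B powr p"]) auto
  have iS: "integrable M (\<lambda>\<omega>. \<bar>S \<omega>\<bar>)" using S by (intro integrable_bounded[of _ L]) auto
  have "\<bar>S \<omega> * F \<omega>\<bar> \<le> L * B" if "\<omega> \<in> space M" for \<omega>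
    unfolding abs_mult using F(2)[OF that] S(2)[of \<omega>] L by (intro mult_mono) auto
  hence iSF: "integrable M (\<lambda>\<omega>. S \<omega> * F \<omega>)"
    using F(1) S(1) by (intro integrable_bounded[of _ "L * B"]) auto
  have "S \<omega> * F \<omega> \<le> K * \<bar>S \<omega>\<bar> + (L * K powr (1 - p)) * (\<bar>F \<omega>\<bar> powr p)" for \<omega>
  proof -
    have "S \<omega> * F \<omega> \<le> \<bar>S \<omega>\<bar> * \<bar>F \<omega>\<bar>" by (simp flip: abs_mult)
    also have "\<dots> \<le> K * \<bar>S \<omega>\<bar> + (L * K powr (1 - p)) * (\<bar>F \<omega>\<bar> powr p)"
    proof (cases "\<bar>F \<omega>\<bar> \<le> K")
      case True
      hence "\<bar>S \<omega>\<bar> * \<bar>F \<omega>\<bar> \<le> K * \<bar>S \<omega>\<bar>" by (subst mult.commute) (rule mult_right_mono, auto)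
      thus ?thesis using L by (simp add: add_increasing2)
    next
      case False
      hence pos: "\<bar>F \<omega>\<bar> > 0" using K by linarith
      have "\<bar>F \<omega>\<bar> = \<bar>F \<omega>\<bar> powr (1 - p) * \<bar>F \<omega>\<bar> powr p" using pos by (simp flip: powr_add)
      also have "\<dots> \<le> K powr (1 - p) * \<bar>F \<omega>\<bar> powr p"
        using False K p by (intro mult_right_mono powr_mono2') auto
      finally have "\<bar>S \<omega>\<bar> * \<bar>F \<omega>\<bar> \<le> L * (K powr (1 - p) * \<bar>F \<omega>\<bar> powr p)"
        using S(2)[of \<omega>] L by (intro mult_mono) auto
      moreover have "0 \<le> K * \<bar>S \<omega>\<bar>" using K by simp
      ultimately show ?thesis by (simp add: mult.assoc)
    qed
    finally show ?thesis .
  qed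
  hence "expectation (\<lambda>\<omega>. S \<omega> * F \<omega>) \<le> expectation (\<lambda>\<omega>. K * \<bar>S \<omega>\<bar> + (L * K powr (1 - p)) * (\<bar>F \<omega>\<bar> powr p))"
    using iF iS iSF by (intro integral_mono) auto
  also have "\<dots> = K * expectation (\<lambda>\<omega>. \<bar>S \<omega>\<bar>) + L * K powr (1 - p)"
    using iF iS F(3) by simp
  finally show ?thesis .
qed

end

section \<open>Binary spreadable arrays\<close>

lemma finite_binom: "finite I \<Longrightarrow> finite (binom I d)"
  unfolding binom_def by (rule finite_subset[of _ "Pow I"]) auto

lemma binom_mono: "I \<subseteq> K \<Longrightarrow> binom I d \<subseteq> binom K d"
  unfolding binom_def by auto

lemma doubleton_in_binom: "i \<in> I \<Longrightarrow> j \<in> I \<Longrightarrow> i \<noteq> j \<Longrightarrow> {i, j} \<in> binom I 2"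
  unfolding binom_def by auto

lemma image_in_binom:
  assumes "t \<in> binom I d" "inj_on u I" "u ` I \<subseteq> K"
  shows "u ` t \<in> binom K d"
  using assms unfolding binom_def
  by (auto simp: card_image inj_on_subset)

lemma measurable_level_pattern:
  fixes Y :: "'b \<Rightarrow> 'a \<Rightarrow> real"
  assumes fS: "finite S" and Y: "\<And>s. s \<in> S \<Longrightarrow> Y s \<in> borel_measurable M"
  shows "(\<lambda>\<omega>. {s \<in> S. Y s \<omega> = 1}) \<in> measurable M (count_space (Pow S))"
proof -
  have "(\<lambda>\<omega>. {s \<in> S. Y s \<omega> = 1}) -` {z} \<inter> space M \<in> sets M" if "z \<in> Pow S" for z
  proof -
    have eq: "(\<lambda>\<omega>. {s \<in> S. Y s \<omega> = 1}) -` {z} \<inter> space M = {\<omega> \<in> space M. \<forall>s\<in>S. (Y s \<omega> = 1) = (s \<in> z)}"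
      using that by auto
    have "{\<omega> \<in> space M. (Y s \<omega> = 1) = (s \<in> z)} \<in> sets M" if "s \<in> S" for s
      using Y[OF that] by measurable
    thus ?thesis unfolding eq by (rule sets.sets_Collect_finite_All[OF _ fS])
  qed
  thus ?thesis
    by (subst measurable_count_space_eq2) (auto simp: fS)
qed

locale binary_array = prob_space M for M :: "'a measure" +
  fixes X :: "nat set \<Rightarrow> 'a \<Rightarrow> real" and n :: nat and \<eta> :: real
  assumes meas: "\<And>s. s \<in> binom {1..n} 2 \<Longrightarrow> X s \<in> borel_measurable M"
    and bin: "\<And>s \<omega>. s \<in> binom {1..n} 2 \<Longrightarrow> \<omega> \<in> space M \<Longrightarrow> X s \<omega> \<in> {0, 1}"
    and spr: "spreadable M X 2 n \<eta>"
begin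

definition edge_set :: "nat set set \<Rightarrow> 'a \<Rightarrow> nat set set" where
  "edge_set S \<omega> = {s \<in> S. X s \<omega> = 1}"

text \<open>The array seen through \<open>u\<close>: \<open>emb r u\<close> embeds the abstract vertices \<open>{0..<r}\<close> increasingly into
  \<open>[n]\<close>, and \<open>pat r u\<close> is the random graph on \<open>{0..<r}\<close> pulled back along \<open>u\<close>.\<close>

definition pat :: "nat \<Rightarrow> (nat \<Rightarrow> nat) \<Rightarrow> 'a \<Rightarrow> nat set set" where
  "pat r u \<omega> = {t \<in> binom {0..<r} 2. X (u ` t) \<omega> = 1}"

definition emb :: "nat \<Rightarrow> (nat \<Rightarrow> nat) \<Rightarrow> bool" where
  "emb r u \<longleftrightarrow> strict_mono_on {0..<r} u \<and> u ` {0..<r} \<subseteq> {1..n}"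

lemma emb_image_binom: "emb r u \<Longrightarrow> t \<in> binom {0..<r} 2 \<Longrightarrow> u ` t \<in> binom {1..n} 2"
  unfolding emb_def by (rule image_in_binom) (auto dest: strict_mono_on_imp_inj_on)

lemma X_eq_of_bool:
  assumes "emb r u" "t \<in> binom {0..<r} 2" "\<omega> \<in> space M"
  shows "X (u ` t) \<omega> = of_bool (t \<in> pat r u \<omega>)"
  using bin[OF emb_image_binom[OF assms(1,2)] assms(3)] assms(2) by (auto simp: pat_def)

lemma edge_set_measurable:
  assumes "S \<subseteq> binom {1..n} 2"
  shows "edge_set S \<in> measurable M (count_space (Pow S))"
  unfolding edge_set_def
proof (rule measurable_level_pattern)
  show "finite S" using assms finite_subset[OF _ finite_binom] by blast
qed (use assms meas in auto)

lemma pat_measurable: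
  assumes "emb r u"
  shows "pat r u \<in> measurable M (count_space (Pow (binom {0..<r} 2)))"
  unfolding pat_def using meas emb_image_binom[OF assms]
  by (intro measurable_level_pattern) (auto simp: finite_binom)

lemma pat_event:
  assumes "emb r u"
  shows "{\<omega> \<in> space M. pat r u \<omega> \<in> Z} \<in> sets M"
proof -
  have "{\<omega> \<in> space M. pat r u \<omega> \<in> Z} = pat r u -` (Z \<inter> Pow (binom {0..<r} 2)) \<inter> space M"
    by (auto simp: pat_def)
  thus ?thesis using measurable_sets[OF pat_measurable[OF assms], of "Z \<inter> Pow (binom {0..<r} 2)"] by simp
qed

lemma pat_fun_measurable:
  "emb r u \<Longrightarrow> (\<lambda>\<omega>. \<Phi> (pat r u \<omega>)) \<in> borel_measurable M"
  by (rule measurable_compose[OF pat_measurable]) auto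

section \<open>Transfer of expectations between increasing embeddings\<close>

lemma expectation_pat:
  fixes \<Phi> :: "nat set set \<Rightarrow> real"
  assumes "emb r u"
  shows "(\<integral>\<omega>. \<Phi> (pat r u \<omega>) \<partial>M) = 
    (\<Sum>z\<in>Pow (binom {0..<r} 2). \<Phi> z * measure M {\<omega> \<in> space M. pat r u \<omega> = z})"
proof -
  have fS: "finite (Pow (binom {0..<r} 2))" by (simp add: finite_binom)
  have m: "{\<omega> \<in> space M. pat r u \<omega> = z} \<in> sets M" if "z \<in> Pow (binom {0..<r} 2)" for z
    using pat_event[OF assms, of "{z}"] by simp
  have "(\<integral>\<omega>. \<Phi> (pat r u \<omega>) \<partial>M) = (\<integral>\<omega>. (\<Sum>z\<in>Pow (binom {0..<r} 2). \<Phi> z * 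
      indicator {\<omega> \<in> space M. pat r u \<omega> = z} \<omega>) \<partial>M)"
  proof (rule Bochner_Integration.integral_cong[OF refl])
    fix \<omega> assume "\<omega> \<in> space M"
    have "pat r u \<omega> \<in> Pow (binom {0..<r} 2)" by (auto simp: pat_def)
    thus "\<Phi> (pat r u \<omega>) = (\<Sum>z\<in>Pow (binom {0..<r} 2). \<Phi> z * indicator {\<omega> \<in> space M. pat r u \<omega> = z} \<omega>)"
      using fS \<open>\<omega> \<in> space M\<close> by (simp add: indicator_def if_distrib[of "(*) _"] cong: if_cong)
  qed
  also have "\<dots> = (\<Sum>z\<in>Pow (binom {0..<r} 2). \<Phi> z * measure M {\<omega> \<in> space M. pat r u \<omega> = z})"
    using m by (subst Bochner_Integration.integral_sum) (auto intro!: integrable_real_indicator simp: emeasure_finite less_top[symmetric])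
  finally show ?thesis .
qed

text \<open>An increasing \<open>u\<close> lists its own image in order, so the sorted enumeration
  inside \<open>subarray_cfg\<close> is composition with \<open>u\<close>. This links
  \<open>spreadable\<close> to \<open>pat\<close>.\<close>

lemma subarray_cfg_emb:
  assumes "emb r u"
  shows "subarray_cfg X 2 (u ` {0..<r}) \<omega> = (\<lambda>t. if t \<in> binom {0..<r} 2 then X (u ` t) \<omega> else 0)"
proof -
  have inj: "inj_on u {0..<r}" using assms by (auto simp: emb_def dest: strict_mono_on_imp_inj_on)
  have c: "card (u ` {0..<r}) = r" using inj by (simp add: card_image)
  have "sorted_list_of_set (u ` {0..<r}) = map u [0..<r]"
  proof (rule sorted_list_of_set.idem_if_sorted_distinct[of "map u [0..<r]", simplified, symmetric, THEN sym])
    show "sorted (map u [0..<r])"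
      using assms by (auto simp: emb_def sorted_iff_nth_mono strict_mono_on_leD)
    show "distinct (map u [0..<r])"
      using inj by (simp add: distinct_map)
  qed
  hence "(\<lambda>i. sorted_list_of_set (u ` {0..<r}) ! i) ` t = u ` t" if "t \<in> binom {0..<r} 2" for t
    using that by (auto simp: binom_def subset_iff intro!: image_cong)
  thus ?thesis unfolding subarray_cfg_def c by auto
qed

lemma measure_pat_diff:
  assumes u: "emb r u" and v: "emb r v" and r: "r \<ge> 2"
  shows "measure M {\<omega> \<in> space M. pat r u \<omega> \<in> Z} - measure M {\<omega> \<in> space M. pat r v \<omega> \<in> Z} \<le> \<eta>"
proof -
  let ?A = "{x. {t \<in> binom {0..<r} 2. x t = (1::real)} \<in> Z}"
  have *: "{\<omega> \<in> space M. pat r w \<omega> \<in> Z} = {\<omega> \<in> space M. subarray_cfg X 2 (w ` {0..<r}) \<omega> \<in> ?A}"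
    if "emb r w" for w
    unfolding subarray_cfg_emb[OF that] by (auto simp: pat_def cong: conj_cong)
  have c: "card (w ` {0..<r}) = r" if "emb r w" for w
    using that by (auto simp: emb_def card_image dest: strict_mono_on_imp_inj_on)
  have "u ` {0..<r} \<subseteq> {1..n}" "v ` {0..<r} \<subseteq> {1..n}" using u v by (auto simp: emb_def)
  thus ?thesis
    using spr[unfolded spreadable_def, rule_format, of "u ` {0..<r}" "v ` {0..<r}" ?A]
    unfolding *[OF u] *[OF v] using c[OF u] c[OF v] r by auto
qed

text \<open>Hahn decomposition: among functions with values in the unit interval, the difference is
  largest for the indicator of \<open>?Z\<close>, where the first law exceeds the second, and that
  is a difference of probabilities of one event.\<close>

lemma spread_transfer_le:
  assumes u: "emb r u" and v: "emb r v" and r: "r \<ge> 2"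
    and \<Phi>: "\<And>z. 0 \<le> \<Phi> z" "\<And>z. \<Phi> z \<le> (1::real)"
  shows "(\<integral>\<omega>. \<Phi> (pat r u \<omega>) \<partial>M) - (\<integral>\<omega>. \<Phi> (pat r v \<omega>) \<partial>M) \<le> \<eta>"
proof -
  let ?S = "Pow (binom {0..<r} 2)"
  have fS: "finite ?S" by (simp add: finite_binom)
  let ?a = "\<lambda>z. measure M {\<omega> \<in> space M. pat r u \<omega> = z}"
  let ?b = "\<lambda>z. measure M {\<omega> \<in> space M. pat r v \<omega> = z}"
  let ?Z = "{z \<in> ?S. ?a z > ?b z}"
  have ms: "measure M {\<omega> \<in> space M. pat r w \<omega> \<in> ?Z} = (\<Sum>z\<in>?Z. measure M {\<omega> \<in> space M. pat r w \<omega> = z})"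
    if w: "emb r w" for w
  proof -
    have "measure M {\<omega> \<in> space M. pat r w \<omega> \<in> ?Z} = (\<integral>\<omega>. indicator ?Z (pat r w \<omega>) \<partial>M)"
    proof -
      have "measure M {\<omega> \<in> space M. pat r w \<omega> \<in> ?Z} = (\<integral>\<omega>. indicator {\<omega> \<in> space M. pat r w \<omega> \<in> ?Z} \<omega> \<partial>M)"
        using pat_event[OF w, of ?Z] by simp
      also have "\<dots> = (\<integral>\<omega>. indicator ?Z (pat r w \<omega>) \<partial>M)"
        by (rule Bochner_Integration.integral_cong) (auto simp: indicator_def)
      finally show ?thesis .
    qed
    also have "\<dots> = (\<Sum>z\<in>?Z. measure M {\<omega> \<in> space M. pat r w \<omega> = z})"
      unfolding expectation_pat[OF w] by (rule sum.mono_neutral_cong_right[OF fS]) auto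
    finally show ?thesis .
  qed
  have "(\<integral>\<omega>. \<Phi> (pat r u \<omega>) \<partial>M) - (\<integral>\<omega>. \<Phi> (pat r v \<omega>) \<partial>M) = (\<Sum>z\<in>?S. \<Phi> z * (?a z - ?b z))"
    unfolding expectation_pat[OF u] expectation_pat[OF v] by (simp add: sum_subtractf right_diff_distrib)
  also have "\<dots> \<le> (\<Sum>z\<in>?S. if ?a z > ?b z then ?a z - ?b z else 0)"
    using \<Phi> by (intro sum_mono) (auto simp: mult_left_le_one_le mult_nonneg_nonpos)
  also have "\<dots> = (\<Sum>z\<in>?Z. ?a z - ?b z)"
    by (rule sum.inter_filter[symmetric]) (rule fS)
  also have "\<dots> \<le> \<eta>"
    using measure_pat_diff[OF u v r, of ?Z] unfolding ms[OF u] ms[OF v] by (simp add: sum_subtractf)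
  finally show ?thesis .
qed

lemma spread_transfer:
  assumes "emb r u" "emb r v" "r \<ge> 2"
    and "\<And>z. 0 \<le> \<Phi> z" "\<And>z. \<Phi> z \<le> (1::real)"
  shows "\<bar>(\<integral>\<omega>. \<Phi> (pat r u \<omega>) \<partial>M) - (\<integral>\<omega>. \<Phi> (pat r v \<omega>) \<partial>M)\<bar> \<le> \<eta>"
  using spread_transfer_le[of r u v \<Phi>] spread_transfer_le[of r v u \<Phi>] assms by auto

text \<open>Rescaling to \<open>(\<Phi> z + 1) / 2\<close> brings \<Phi> into the unit interval;
  undoing this doubles the error.\<close>

lemma spread_transfer_abs:
  assumes "emb r u" "emb r v" "r \<ge> 2" and \<Phi>: "\<And>z. \<bar>\<Phi> z\<bar> \<le> (1::real)"
  shows "\<bar>(\<integral>\<omega>. \<Phi> (pat r u \<omega>) \<partial>M) - (\<integral>\<omega>. \<Phi> (pat r v \<omega>) \<partial>M)\<bar> \<le> 2 * \<eta>"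
proof -
  have i: "integrable M (\<lambda>\<omega>. \<Phi> (pat r w \<omega>))" if "emb r w" for w
    using pat_fun_measurable[OF that] \<Phi> by (intro integrable_bounded[of _ 1]) auto
  have "\<bar>(\<integral>\<omega>. (\<Phi> (pat r u \<omega>) + 1) / 2 \<partial>M) - (\<integral>\<omega>. (\<Phi> (pat r v \<omega>) + 1) / 2 \<partial>M)\<bar> \<le> \<eta>"
  proof (rule spread_transfer[OF assms(1-3)])
    fix z show "0 \<le> (\<Phi> z + 1) / 2" "(\<Phi> z + 1) / 2 \<le> 1" using \<Phi>[of z] by auto
  qed
  thus ?thesis using i[OF assms(1)] i[OF assms(2)] by (simp add: prob_space add_divide_distrib flip: diff_divide_distrib)
qed

lemma emb_list:
  assumes "sorted_wrt (<) xs" "set xs \<subseteq> {1..n}" "length xs = r"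
  shows "emb r ((!) xs)"
  unfolding emb_def
proof
  show "strict_mono_on {0..<r} ((!) xs)"
    using assms by (auto simp: strict_mono_on_def sorted_wrt_iff_nth_less)
  show "(!) xs ` {0..<r} \<subseteq> {1..n}" using assms(2,3) by (auto simp: image_subset_iff subset_iff)
qed

lemma X_bounds:
  assumes "x \<in> {1..n}" "y \<in> {1..n}" "x \<noteq> y" "\<omega> \<in> space M"
  shows "0 \<le> X {x, y} \<omega> \<and> X {x, y} \<omega> \<le> 1"
  using bin[OF doubleton_in_binom[OF assms(1-3)] assms(4)] by auto

lemma X_meas: "x \<in> {1..n} \<Longrightarrow> y \<in> {1..n} \<Longrightarrow> x \<noteq> y \<Longrightarrow> X {x, y} \<in> borel_measurable M"
  by (intro meas doubleton_in_binom)

text \<open>For binary entries the product is the indicator of \<open>T\<close> being contained in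
  the pattern, so the cost is a single \<eta> however many edges \<open>T\<close> has.\<close>

lemma edge_product_transfer:
  assumes u: "emb r u" and v: "emb r v" and r: "r \<ge> 2" and T: "T \<subseteq> binom {0..<r} 2"
  shows "\<bar>(\<integral>\<omega>. (\<Prod>t\<in>T. X (u ` t) \<omega>) \<partial>M) - (\<integral>\<omega>. (\<Prod>t\<in>T. X (v ` t) \<omega>) \<partial>M)\<bar> \<le> \<eta>"
proof -
  have fT: "finite T" using T finite_binom finite_subset by blast
  have *: "(\<integral>\<omega>. (\<Prod>t\<in>T. X (w ` t) \<omega>) \<partial>M) = (\<integral>\<omega>. of_bool (T \<subseteq> pat r w \<omega>) \<partial>M)" if w: "emb r w" for w
  proof (rule Bochner_Integration.integral_cong[OF refl])
    fix \<omega> assume \<omega>: "\<omega> \<in> space M"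
    have "(\<Prod>t\<in>T. X (w ` t) \<omega>) = (\<Prod>t\<in>T. of_bool (t \<in> pat r w \<omega>))"
      using X_eq_of_bool[OF w _ \<omega>] T by (intro prod.cong) auto
    also have "\<dots> = of_bool (T \<subseteq> pat r w \<omega>)"
      unfolding prod_of_bool[OF fT] by (auto simp: subset_iff)
    finally show "(\<Prod>t\<in>T. X (w ` t) \<omega>) = of_bool (T \<subseteq> pat r w \<omega>)" .
  qed
  show ?thesis unfolding *[OF u] *[OF v]
    by (rule spread_transfer[OF u v r, of "\<lambda>z. of_bool (T \<subseteq> z)"]) auto
qed

lemma edge_transfer:
  assumes "1 \<le> x" "x < y" "y \<le> n" "2 \<le> n"
  shows "\<bar>(\<integral>\<omega>. X {x, y} \<omega> \<partial>M) - (\<integral>\<omega>. X {1, 2} \<omega> \<partial>M)\<bar> \<le> \<eta>"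
  using edge_product_transfer[OF emb_list[of "[x, y]" 2] emb_list[of "[1, 2]" 2], of "{{0,1}}"] assms
  by (simp add: doubleton_in_binom)

text \<open>A pointwise form of measurability with respect to the sigma-algebra of the subarray on
  \<open>J\<close>. Having no exceptional null set, it makes \<open>g\<close> literally a function
  of a finite graph.\<close>

definition determined :: "nat set \<Rightarrow> ('a \<Rightarrow> real) \<Rightarrow> bool" where
  "determined J g \<longleftrightarrow> (\<forall>\<omega>\<in>space M. \<forall>\<omega>'\<in>space M. (\<forall>s\<in>binom J 2. X s \<omega> = X s \<omega>') \<longrightarrow> g \<omega> = g \<omega>')"

text \<open>A finite Doob--Dynkin factorisation: each trace on \<open>binom I 2\<close> gets a
  representative outcome. Comparing traces instead of whole patterns makes \<open>G\<close> blind to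
  all edges not inside \<open>I\<close>, which the decoupling of two blocks relies on.\<close>

lemma determined_pattern:
  assumes u: "emb r u" and I: "I \<subseteq> {0..<r}" and g: "determined (u ` I) g"
    and b: "\<And>\<omega>. \<omega> \<in> space M \<Longrightarrow> \<bar>g \<omega>\<bar> \<le> K"
  obtains G where "\<And>z. \<bar>G z\<bar> \<le> K" "\<And>z z'. z \<inter> binom I 2 = z' \<inter> binom I 2 \<Longrightarrow> G z = G z'"
    "\<And>\<omega>. \<omega> \<in> space M \<Longrightarrow> g \<omega> = G (pat r u \<omega>)"
proof -
  define R where "R = (\<lambda>z \<omega>. \<omega> \<in> space M \<and> pat r u \<omega> \<inter> binom I 2 = z \<inter> binom I 2)"
  \<comment> \<open>Traces that no outcome realises get 0; this respects the bound because
    \<open>K \<ge> 0\<close> on a nonempty space.\<close>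
  define G where "G = (\<lambda>z. if \<exists>\<omega>. R z \<omega> then g (SOME \<omega>. R z \<omega>) else 0)"
  obtain \<omega>0 where "\<omega>0 \<in> space M" using not_empty by blast
  hence K: "0 \<le> K" using b by fastforce
  show ?thesis
  proof (rule that)
    show "\<bar>G z\<bar> \<le> K" for z
    proof (cases "\<exists>\<omega>. R z \<omega>")
      case True
      hence "R z (SOME \<omega>. R z \<omega>)" by (rule someI_ex)
      thus ?thesis using True b by (simp add: G_def R_def)
    next
      case False
      hence "G z = 0" unfolding G_def by (rule if_not_P)
      thus ?thesis using K by simp
    qed
    show "G z = G z'" if "z \<inter> binom I 2 = z' \<inter> binom I 2" for z z'
    proof -
      have "R z = R z'" using that by (simp add: R_def)
      thus ?thesis by (simp only: G_def)
    qed
    show "g \<omega> = G (pat r u \<omega>)" if \<omega>: "\<omega> \<in> space M" for \<omega>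
    proof -
      let ?\<omega>' = "SOME \<omega>'. R (pat r u \<omega>) \<omega>'"
      have ex: "R (pat r u \<omega>) \<omega>" using \<omega> by (simp add: R_def)
      define \<omega>' where "\<omega>' = ?\<omega>'"
      have R: "R (pat r u \<omega>) \<omega>'" unfolding \<omega>'_def using ex by (rule someI)
      have G': "G (pat r u \<omega>) = g \<omega>'" unfolding G_def \<omega>'_def by (rule if_P) (use ex in blast)
      have "X s \<omega> = X s \<omega>'" if s: "s \<in> binom (u ` I) 2" for s
      proof -
        have inj: "inj_on u {0..<r}" using u by (auto simp: emb_def dest: strict_mono_on_imp_inj_on)
        obtain t where t: "t \<subseteq> I" "s = u ` t" using s by (auto simp: binom_def subset_image_iff)
        have "card t = 2" using s t inj I by (simp add: binom_def card_image inj_on_subset)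
        hence tI: "t \<in> binom I 2" using t by (simp add: binom_def)
        hence tr: "t \<in> binom {0..<r} 2" using binom_mono[OF I] by auto
        have "t \<in> pat r u \<omega> \<longleftrightarrow> t \<in> pat r u \<omega>'" using R tI by (auto simp: R_def)
        thus ?thesis using X_eq_of_bool[OF u tr] \<omega> R t(2) by (simp add: R_def)
      qed
      moreover have "\<omega>' \<in> space M" using R by (simp add: R_def)
      ultimately show ?thesis using g \<omega> unfolding G' determined_def by blast
    qed
  qed
qed

lemma determined_edge_set:
  assumes g: "determined J g" and J: "J \<subseteq> {1..n}"
  obtains G where "\<And>\<omega>. \<omega> \<in> space M \<Longrightarrow> g \<omega> = G (edge_set (binom J 2) \<omega>)"
proof -
  define pick where "pick = (\<lambda>z. SOME \<omega>. \<omega> \<in> space M \<and> edge_set (binom J 2) \<omega> = z)"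
  have "g \<omega> = g (pick (edge_set (binom J 2) \<omega>))" if \<omega>: "\<omega> \<in> space M" for \<omega>
  proof -
    define \<omega>' where "\<omega>' = pick (edge_set (binom J 2) \<omega>)"
    have "\<omega>' \<in> space M \<and> edge_set (binom J 2) \<omega>' = edge_set (binom J 2) \<omega>"
      unfolding \<omega>'_def pick_def by (rule someI[of _ \<omega>]) (simp add: \<omega>)
    hence R: "\<omega>' \<in> space M" "edge_set (binom J 2) \<omega>' = edge_set (binom J 2) \<omega>" by auto
    have "X s \<omega> = X s \<omega>'" if s: "s \<in> binom J 2" for s
    proof -
      have "s \<in> binom {1..n} 2" using s binom_mono[OF J] by auto
      hence "X s \<omega> \<in> {0, 1}" "X s \<omega>' \<in> {0, 1}" using bin \<omega> R(1) by auto
      moreover have "X s \<omega> = 1 \<longleftrightarrow> X s \<omega>' = 1" using R(2) s unfolding edge_set_def by blast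
      ultimately show ?thesis by auto
    qed
    thus ?thesis using g \<omega> R(1) unfolding determined_def \<omega>'_def by blast
  qed
  thus ?thesis by (rule that[of "\<lambda>z. g (pick z)"])
qed

lemma determined_measurable:
  assumes "determined J g" "J \<subseteq> {1..n}"
  shows "g \<in> borel_measurable M"
proof -
  obtain G where G: "\<And>\<omega>. \<omega> \<in> space M \<Longrightarrow> g \<omega> = G (edge_set (binom J 2) \<omega>)"
    using determined_edge_set[OF assms] by blast
  have "(\<lambda>\<omega>. G (edge_set (binom J 2) \<omega>)) \<in> borel_measurable M"
    by (rule measurable_compose[OF edge_set_measurable[OF binom_mono[OF assms(2)]]]) auto
  thus ?thesis using G by (simp cong: measurable_cong)
qed

lemma determined_bounded:
  assumes "determined J g" "J \<subseteq> {1..n}"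
  obtains K where "\<And>\<omega>. \<omega> \<in> space M \<Longrightarrow> \<bar>g \<omega>\<bar> \<le> K"
proof -
  obtain G where G: "\<And>\<omega>. \<omega> \<in> space M \<Longrightarrow> g \<omega> = G (edge_set (binom J 2) \<omega>)"
    using determined_edge_set[OF assms] by blast
  have f: "finite (Pow (binom J 2))" using finite_binom[of J] assms(2) finite_subset by auto
  have "\<bar>g \<omega>\<bar> \<le> (\<Sum>z\<in>Pow (binom J 2). \<bar>G z\<bar>)" if "\<omega> \<in> space M" for \<omega>
    unfolding G[OF that] using f by (intro member_le_sum) (auto simp: edge_set_def)
  thus ?thesis using that by blast
qed

lemma apply_array_determined: "determined {1..n} (apply_array f X 2 n)"
  unfolding determined_def apply_array_def by (auto intro!: arg_cong[of _ _ f])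

section \<open>Sigma-algebras of subarrays and test functions\<close>

lemma gen_sigma_subalgebra:
  assumes "J \<subseteq> {1..n}"
  shows "subalgebra M (gen_sigma M X 2 J)"
proof -
  have "{X s -` B \<inter> space M | s B. s \<in> binom J 2 \<and> B \<in> sets borel} \<subseteq> sets M"
    using meas binom_mono[OF assms, of 2] by (auto intro!: measurable_sets)
  thus ?thesis unfolding subalgebra_def gen_sigma_def
    by (auto simp: space_measure_of_conv sets_measure_of_conv dest: sets.sigma_sets_subset)
qed

text \<open>By induction over the generated sigma-algebra, none of its sets separates two outcomes
  with the same subarray; apply this to the level set of \<open>g\<close> through one of
  them.\<close>

lemma gen_sigma_determined:
  assumes J: "J \<subseteq> {1..n}" and g: "g \<in> borel_measurable (gen_sigma M X 2 J)"
  shows "determined J g"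
proof -
  let ?\<A> = "{X s -` B \<inter> space M | s B. s \<in> binom J 2 \<and> B \<in> sets (borel :: real measure)}"
  have sp: "space (gen_sigma M X 2 J) = space M" by (simp add: gen_sigma_def space_measure_of_conv)
  have st: "sets (gen_sigma M X 2 J) = sigma_sets (space M) ?\<A>"
    unfolding gen_sigma_def by (rule sets_measure_of) auto
  have sat: "\<omega> \<in> A \<longleftrightarrow> \<omega>' \<in> A"
    if "A \<in> sigma_sets (space M) ?\<A>" "\<omega> \<in> space M" "\<omega>' \<in> space M" "\<forall>s\<in>binom J 2. X s \<omega> = X s \<omega>'" for A \<omega> \<omega>'
    using that by (induction rule: sigma_sets.induct) auto
  show ?thesis unfolding determined_def
  proof (intro ballI impI)
    fix \<omega> \<omega>' assume *: "\<omega> \<in> space M" "\<omega>' \<in> space M" "\<forall>s\<in>binom J 2. X s \<omega> = X s \<omega>'"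
    have "g -` {g \<omega>} \<inter> space M \<in> sigma_sets (space M) ?\<A>"
      using measurable_sets[OF g, of "{g \<omega>}"] sp st by simp
    from sat[OF this *] show "g \<omega> = g \<omega>'" using * by auto
  qed
qed

text \<open>The witness is the sign of the conditional expectation \<open>g\<close>, cut down to
  where its absolute value exceeds \<epsilon>. Being measurable for the subarray, it pairs with
  \<open>F\<close> as it does with \<open>g\<close>, and there the integrand is at least \<epsilon>
  on an event of probability above \<epsilon>.\<close>

lemma test_function:
  assumes J: "J \<subseteq> {1..n}" and F: "F \<in> borel_measurable M" "\<And>\<omega>. \<omega> \<in> space M \<Longrightarrow> \<bar>F \<omega>\<bar> \<le> K"
    and \<epsilon>: "0 < \<epsilon>"
    and fail: "measure M {\<omega> \<in> space M. \<bar>real_cond_exp M (gen_sigma M X 2 J) F \<omega>\<bar> \<le> \<epsilon>} < 1 - \<epsilon>"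
  obtains h where "determined J h" "\<And>\<omega>. \<bar>h \<omega>\<bar> \<le> 1" "\<epsilon>\<^sup>2 \<le> expectation (\<lambda>\<omega>. h \<omega> * F \<omega>)"
proof -
  define S where "S = gen_sigma M X 2 J"
  have sub: "subalgebra M S" unfolding S_def by (rule gen_sigma_subalgebra[OF J])
  interpret fin: finite_measure_subalgebra M S using sub by unfold_locales
  define g where "g = real_cond_exp M S F"
  define h where "h = (\<lambda>\<omega>. if \<bar>g \<omega>\<bar> > \<epsilon> then sgn (g \<omega>) else 0)"
  have gS: "g \<in> borel_measurable S" unfolding g_def by simp
  have gM: "g \<in> borel_measurable M" using gS sub by (rule measurable_from_subalg[rotated])
  have hS: "h \<in> borel_measurable S" unfolding h_def using gS by measurable
  have hM: "h \<in> borel_measurable M" using hS sub by (rule measurable_from_subalg[rotated])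
  have h1: "\<bar>h \<omega>\<bar> \<le> 1" for \<omega> by (auto simp: h_def sgn_if)
  have i: "integrable M (\<lambda>\<omega>. h \<omega> * F \<omega>)"
  proof (rule integrable_bounded[of _ K])
    show "\<bar>h \<omega> * F \<omega>\<bar> \<le> K" if "\<omega> \<in> space M" for \<omega>
      using F(2)[OF that] h1[of \<omega>] unfolding abs_mult
      by (intro order_trans[OF mult_left_le_one_le]) auto
  qed (use hM F in auto)
  note ce = fin.real_cond_exp_intg[OF i hS F(1), folded g_def]
  have ev: "{\<omega> \<in> space M. \<bar>g \<omega>\<bar> \<le> \<epsilon>} \<in> sets M" using gM by measurable
  have ev2: "{\<omega> \<in> space M. \<bar>g \<omega>\<bar> > \<epsilon>} \<in> sets M" using gM by measurable
  have "{\<omega> \<in> space M. \<bar>g \<omega>\<bar> > \<epsilon>} = space M - {\<omega> \<in> space M. \<bar>g \<omega>\<bar> \<le> \<epsilon>}" by auto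
  hence "\<epsilon> < measure M {\<omega> \<in> space M. \<bar>g \<omega>\<bar> > \<epsilon>}"
    using fail prob_compl[OF ev] unfolding g_def[symmetric] S_def[symmetric] by simp
  hence "\<epsilon>\<^sup>2 \<le> \<epsilon> * measure M {\<omega> \<in> space M. \<bar>g \<omega>\<bar> > \<epsilon>}"
    using \<epsilon> by (simp add: power2_eq_square)
  also have "\<dots> = expectation (\<lambda>\<omega>. \<epsilon> * indicator {\<omega> \<in> space M. \<bar>g \<omega>\<bar> > \<epsilon>} \<omega>)"
    using ev2 by simp
  also have "\<dots> \<le> expectation (\<lambda>\<omega>. h \<omega> * g \<omega>)"
  proof (rule integral_mono)
    show "integrable M (\<lambda>\<omega>. \<epsilon> * indicator {\<omega> \<in> space M. \<bar>g \<omega>\<bar> > \<epsilon>} \<omega>)"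
      using ev2 by (intro integrable_mult_right integrable_real_indicator) (auto simp: less_top[symmetric])
    show "\<epsilon> * indicator {\<omega> \<in> space M. \<bar>g \<omega>\<bar> > \<epsilon>} \<omega> \<le> h \<omega> * g \<omega>" for \<omega>
      using \<epsilon> by (auto simp: h_def indicator_def sgn_mult_self_eq abs_sgn[symmetric] sgn_if)
  qed (rule ce(1))
  also have "\<dots> = expectation (\<lambda>\<omega>. h \<omega> * F \<omega>)" by (rule ce(2))
  finally have "\<epsilon>\<^sup>2 \<le> expectation (\<lambda>\<omega>. h \<omega> * F \<omega>)" .
  moreover have "determined J h" using gen_sigma_determined[OF J] hS by (simp add: S_def)
  ultimately show ?thesis using that h1 by blast
qed

end

section \<open>Decorrelation of disjoint blocks\<close>

text \<open>In \<open>box\<close> the four edge means are already replaced by the mean of a single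
  edge: one \<eta> stems from the original condition and four from spreadability.\<close>

locale quasirandom_array = binary_array +
  fixes \<tau> :: real and N :: nat
  assumes n4: "n \<ge> 4" and \<eta>_nonneg: "\<eta> \<ge> 0" and N_pos: "N > 0"
    and \<tau>: "0 < \<tau>" "\<tau> \<le> 1" "14 * \<eta> + 3 / N \<le> \<tau> ^ 8"
    and box: "(\<integral>\<omega>. X {1,3} \<omega> * X {1,4} \<omega> * X {2,3} \<omega> * X {2,4} \<omega> \<partial>M)
      \<le> (\<integral>\<omega>. X {1,2} \<omega> \<partial>M) ^ 4 + 5 * \<eta>"
begin

section \<open>Blowing up one edge to an ordered bipartite family\<close>

definition dens :: real where "dens = (\<integral>\<omega>. X {1,2} \<omega> \<partial>M)"

lemma dens_bounds: "0 \<le> dens" "dens \<le> 1"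
  using expectation_unit_interval[of "X {1,2}"] X_meas[of 1 2] X_bounds[of 1 2] n4 by (auto simp: dens_def)

text \<open>Left and right cherries are different increasing configurations on three points, so each
  kind needs its own reference density.\<close>

lemma left_cherry_transfer:
  assumes "1 \<le> x" "x < x'" "x' < y" "y \<le> n"
  shows "\<bar>(\<integral>\<omega>. X {x, y} \<omega> * X {x', y} \<omega> \<partial>M) - (\<integral>\<omega>. X {1, 3} \<omega> * X {2, 3} \<omega> \<partial>M)\<bar> \<le> \<eta>"
  using edge_product_transfer[OF emb_list[of "[x, x', y]" 3] emb_list[of "[1, 2, 3]" 3], of "{{0,2},{1,2}}"] assms n4
  by (simp add: doubleton_in_binom doubleton_eq_iff)

lemma right_cherry_transfer:
  assumes "1 \<le> x" "x < y" "y < y'" "y' \<le> n"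
  shows "\<bar>(\<integral>\<omega>. X {x, y} \<omega> * X {x, y'} \<omega> \<partial>M) - (\<integral>\<omega>. X {1, 2} \<omega> * X {1, 3} \<omega> \<partial>M)\<bar> \<le> \<eta>"
  using edge_product_transfer[OF emb_list[of "[x, y, y']" 3] emb_list[of "[1, 2, 3]" 3], of "{{0,1},{0,2}}"] assms n4
  by (simp add: doubleton_in_binom doubleton_eq_iff)

lemma four_cycle_transfer:
  assumes "1 \<le> x" "x < x'" "x' < y" "y < y'" "y' \<le> n"
  shows "\<bar>(\<integral>\<omega>. (X {x, y} \<omega> * X {x', y} \<omega>) * (X {x, y'} \<omega> * X {x', y'} \<omega>) \<partial>M) -
    (\<integral>\<omega>. X {1,3} \<omega> * X {1,4} \<omega> * X {2,3} \<omega> * X {2,4} \<omega> \<partial>M)\<bar> \<le> \<eta>"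
  using edge_product_transfer[OF emb_list[of "[x, x', y, y']" 4] emb_list[of "[1, 2, 3, 4]" 4],
      of "{{0,2},{1,2},{0,3},{1,3}}"] assms n4
  by (simp add: doubleton_in_binom doubleton_eq_iff mult_ac)

text \<open>The conditions on \<open>l\<close> and \<open>r\<close> place all left copies before all
  right copies, so that every cherry and four-cycle in the family becomes an increasing
  configuration once each side is sorted.\<close>

lemma bipartite_decorrelation:
  fixes U V :: "nat \<Rightarrow> 'a \<Rightarrow> real"
  assumes l: "1 \<le> l" "l + N \<le> r" "r + N \<le> n + 1"
    and U: "\<And>a. a < N \<Longrightarrow> U a \<in> borel_measurable M" "\<And>a \<omega>. \<bar>U a \<omega>\<bar> \<le> 1"
    and V: "\<And>b. b < N \<Longrightarrow> V b \<in> borel_measurable M" "\<And>b \<omega>. \<bar>V b \<omega>\<bar> \<le> 1"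
  shows "\<bar>\<Sum>a<N. \<Sum>b<N. expectation (\<lambda>\<omega>. (X {l + a, r + b} \<omega> - dens) * U a \<omega> * V b \<omega>)\<bar> \<le> (9 / 4) * \<tau> * (real N)^2"
proof (rule quasirandom_decorrelation[where D = "\<lambda>a b. X {l + a, r + b}" and \<eta> = \<eta>
      and rL = "\<integral>\<omega>. X {1, 3} \<omega> * X {2, 3} \<omega> \<partial>M" and rR = "\<integral>\<omega>. X {1, 2} \<omega> * X {1, 3} \<omega> \<partial>M"
      and q = "\<integral>\<omega>. X {1,3} \<omega> * X {1,4} \<omega> * X {2,3} \<omega> * X {2,4} \<omega> \<partial>M"])
  have m: "X {i, j} \<in> borel_measurable M" if "1 \<le> i" "i < j" "j \<le> n" for i j
    using X_meas that by auto
  have b: "0 \<le> X {i, j} \<omega> \<and> X {i, j} \<omega> \<le> 1" if "1 \<le> i" "i < j" "j \<le> n" "\<omega> \<in> space M" for i j \<omega>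
    using X_bounds that by auto
  have rL: "0 \<le> (\<integral>\<omega>. X {1, 3} \<omega> * X {2, 3} \<omega> \<partial>M) \<and> (\<integral>\<omega>. X {1, 3} \<omega> * X {2, 3} \<omega> \<partial>M) \<le> 1"
    using m[of 1 3] m[of 2 3] b[of 1 3] b[of 2 3] n4
    by (intro expectation_unit_interval) (auto intro: mult_le_one)
  thus "0 \<le> (\<integral>\<omega>. X {1, 3} \<omega> * X {2, 3} \<omega> \<partial>M)" "(\<integral>\<omega>. X {1, 3} \<omega> * X {2, 3} \<omega> \<partial>M) \<le> 1" by auto
  have rR: "0 \<le> (\<integral>\<omega>. X {1, 2} \<omega> * X {1, 3} \<omega> \<partial>M) \<and> (\<integral>\<omega>. X {1, 2} \<omega> * X {1, 3} \<omega> \<partial>M) \<le> 1"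
    using m[of 1 2] m[of 1 3] b[of 1 2] b[of 1 3] n4
    by (intro expectation_unit_interval) (auto intro: mult_le_one)
  thus "0 \<le> (\<integral>\<omega>. X {1, 2} \<omega> * X {1, 3} \<omega> \<partial>M)" "(\<integral>\<omega>. X {1, 2} \<omega> * X {1, 3} \<omega> \<partial>M) \<le> 1" by auto
  show "0 \<le> (\<integral>\<omega>. X {1,3} \<omega> * X {1,4} \<omega> * X {2,3} \<omega> * X {2,4} \<omega> \<partial>M)"
    using b[of 1 3] b[of 1 4] b[of 2 3] b[of 2 4] n4 by (intro Bochner_Integration.integral_nonneg) auto
  show "(\<integral>\<omega>. X {1,3} \<omega> * X {1,4} \<omega> * X {2,3} \<omega> * X {2,4} \<omega> \<partial>M) \<le> dens ^ 4 + 5 * \<eta>"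
    using box by (simp add: dens_def)
  show "X {l + a, r + b} \<in> borel_measurable M" if "a < N" "b < N" for a b
    using that l by (intro m) auto
  show "0 \<le> X {l + a, r + b'} \<omega> \<and> X {l + a, r + b'} \<omega> \<le> 1" if "a < N" "b' < N" "\<omega> \<in> space M" for a b' \<omega>
    using that l by (intro b) auto
  show "\<bar>expectation (X {l + a, r + b}) - dens\<bar> \<le> \<eta>" if "a < N" "b < N" for a b
    using that l n4 by (intro edge_transfer[folded dens_def]) auto
  show "\<bar>expectation (\<lambda>\<omega>. X {l + a, r + b} \<omega> * X {l + a', r + b} \<omega>) - expectation (\<lambda>\<omega>. X {1, 3} \<omega> * X {2, 3} \<omega>)\<bar> \<le> \<eta>"
    if "a < N" "a' < N" "b < N" "a \<noteq> a'" for a a' b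
    using left_cherry_transfer[of "l + a" "l + a'" "r + b"] left_cherry_transfer[of "l + a'" "l + a" "r + b"] that l
    by (cases "a < a'") (auto simp: mult.commute)
  show "\<bar>expectation (\<lambda>\<omega>. X {l + a, r + b} \<omega> * X {l + a, r + b'} \<omega>) - expectation (\<lambda>\<omega>. X {1, 2} \<omega> * X {1, 3} \<omega>)\<bar> \<le> \<eta>"
    if "a < N" "b < N" "b' < N" "b \<noteq> b'" for a b b'
    using right_cherry_transfer[of "l + a" "r + b" "r + b'"] right_cherry_transfer[of "l + a" "r + b'" "r + b"] that l
    by (cases "b < b'") (auto simp: mult.commute)
  show "\<bar>expectation (\<lambda>\<omega>. X {l + a, r + b} \<omega> * X {l + a', r + b} \<omega> * (X {l + a, r + b'} \<omega> * X {l + a', r + b'} \<omega>)) -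
      (\<integral>\<omega>. X {1,3} \<omega> * X {1,4} \<omega> * X {2,3} \<omega> * X {2,4} \<omega> \<partial>M)\<bar> \<le> \<eta>"
    if "a < N" "a' < N" "b < N" "b' < N" "a \<noteq> a'" "b \<noteq> b'" for a a' b b'
  proof -
    \<comment> \<open>The product is symmetric in \<open>a\<close>, \<open>a'\<close> and in
      \<open>b\<close>, \<open>b'\<close>, so the increasing order settles all four cases.\<close>
    have *: "\<bar>expectation (\<lambda>\<omega>. X {l + a, r + b} \<omega> * X {l + a', r + b} \<omega> * (X {l + a, r + b'} \<omega> * X {l + a', r + b'} \<omega>)) -
      (\<integral>\<omega>. X {1,3} \<omega> * X {1,4} \<omega> * X {2,3} \<omega> * X {2,4} \<omega> \<partial>M)\<bar> \<le> \<eta>"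
      if "a < N" "a' < N" "b < N" "b' < N" "a < a'" "b < b'" for a a' b b'
      using that l by (intro four_cycle_transfer) auto
    consider "a < a'" "b < b'" | "a' < a" "b < b'" | "a < a'" "b' < b" | "a' < a" "b' < b"
      using \<open>a \<noteq> a'\<close> \<open>b \<noteq> b'\<close> by linarith
    thus ?thesis
      using *[of a a' b b'] *[of a' a b b'] *[of a a' b' b] *[of a' a b' b] \<open>a < N\<close> \<open>a' < N\<close> \<open>b < N\<close> \<open>b' < N\<close>
      by cases (simp_all add: mult_ac)
  qed
qed (use N_pos dens_bounds \<eta>_nonneg \<tau> U V in auto)

text \<open>\<open>A\<close> ignores the edges at \<open>j\<close> and \<open>B\<close> those at
  \<open>i\<close>. After the blow-up \<open>A\<close> hence depends only on the copy of
  \<open>i\<close> and \<open>B\<close> only on the copy of \<open>j\<close>, which is the product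
  form \<open>U a * V b\<close> required by the bipartite estimate.\<close>

lemma edge_decorrelation:
  assumes u: "emb r u" and ij: "i < j" "j < r" and rN: "r * N \<le> n"
    and A: "\<And>z z'. (\<And>t. j \<notin> t \<Longrightarrow> t \<in> z \<longleftrightarrow> t \<in> z') \<Longrightarrow> A z = A z'" "\<And>z. \<bar>A z\<bar> \<le> 1"
    and B: "\<And>z z'. (\<And>t. i \<notin> t \<Longrightarrow> t \<in> z \<longleftrightarrow> t \<in> z') \<Longrightarrow> B z = B z'" "\<And>z. \<bar>B z\<bar> \<le> 1"
  shows "\<bar>expectation (\<lambda>\<omega>. (of_bool ({i, j} \<in> pat r u \<omega>) - dens) * A (pat r u \<omega>) * B (pat r u \<omega>))\<bar> \<le> 3 * \<tau>"
proof -
  \<comment> \<open>Vertices are spread out with gaps \<open>N\<close>, which leaves room for \<open>N\<close> copies of \<open>i\<close> and of \<open>j\<close>.\<close>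
  define w where "w = (\<lambda>a b t. 1 + t * N + (if t = i then a else if t = j then b else 0))"
  define \<Phi> where "\<Phi> = (\<lambda>z. (of_bool ({i, j} \<in> z) - dens) * A z * B z)"
  have w_bd: "1 + t * N \<le> w a b t \<and> w a b t < 1 + Suc t * N" if "a < N" "b < N" for a b t
    using that N_pos unfolding w_def by auto
  have w: "emb r (w a b)" if "a < N" "b < N" for a b
    unfolding emb_def
  proof
    show "strict_mono_on {0..<r} (w a b)"
    proof (rule strict_mono_onI)
      fix s t :: nat assume "s < t"
      hence "Suc s * N \<le> t * N" by (intro mult_right_mono) auto
      thus "w a b s < w a b t" using w_bd[OF that, of s] w_bd[OF that, of t] by linarith
    qed
    show "w a b ` {0..<r} \<subseteq> {1..n}"
    proof (clarsimp)
      fix t assume "t < r"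
      hence "Suc t * N \<le> r * N" by (intro mult_right_mono) auto
      thus "Suc 0 \<le> w a b t \<and> w a b t \<le> n" using w_bd[OF that, of t] rN by linarith
    qed
  qed
  have \<Phi>1: "\<bar>\<Phi> z\<bar> \<le> 1" for z
  proof -
    have "\<bar>of_bool ({i, j} \<in> z) - dens\<bar> \<le> 1" using dens_bounds by auto
    thus ?thesis unfolding \<Phi>_def using A(2) B(2) by (intro abs_mult_le_one)
  qed
  have ijb: "{i, j} \<in> binom {0..<r} 2" using ij by (intro doubleton_in_binom) auto
  have l: "1 \<le> 1 + i * N" "1 + i * N + N \<le> 1 + j * N" "1 + j * N + N \<le> n + 1"
  proof -
    have "Suc i * N \<le> j * N" "Suc j * N \<le> r * N" using ij by (auto intro!: mult_right_mono simp del: mult_Suc)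
    thus "1 \<le> 1 + i * N" "1 + i * N + N \<le> 1 + j * N" "1 + j * N + N \<le> n + 1" using rN by auto
  qed
  have eq: "expectation (\<lambda>\<omega>. \<Phi> (pat r (w a b) \<omega>)) = expectation (\<lambda>\<omega>. (X {1 + i * N + a, 1 + j * N + b} \<omega> - dens) *
      A (pat r (w a 0) \<omega>) * B (pat r (w 0 b) \<omega>))" if ab: "a < N" "b < N" for a b
  proof (rule Bochner_Integration.integral_cong[OF refl])
    fix \<omega> assume \<omega>: "\<omega> \<in> space M"
    have "w a b ` {i, j} = {1 + i * N + a, 1 + j * N + b}" using ij by (auto simp: w_def)
    hence "X {1 + i * N + a, 1 + j * N + b} \<omega> = of_bool ({i, j} \<in> pat r (w a b) \<omega>)"
      using X_eq_of_bool[OF w[OF ab] ijb \<omega>] by simp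
    moreover have "A (pat r (w a b) \<omega>) = A (pat r (w a 0) \<omega>)"
    proof (rule A(1))
      fix t assume "j \<notin> t"
      hence "w a b ` t = w a 0 ` t" by (intro image_cong) (auto simp: w_def)
      thus "(t \<in> pat r (w a b) \<omega>) = (t \<in> pat r (w a 0) \<omega>)" by (simp add: pat_def)
    qed
    moreover have "B (pat r (w a b) \<omega>) = B (pat r (w 0 b) \<omega>)"
    proof (rule B(1))
      fix t assume "i \<notin> t"
      hence "w a b ` t = w 0 b ` t" by (intro image_cong) (auto simp: w_def)
      thus "(t \<in> pat r (w a b) \<omega>) = (t \<in> pat r (w 0 b) \<omega>)" by (simp add: pat_def)
    qed
    ultimately show "\<Phi> (pat r (w a b) \<omega>) = (X {1 + i * N + a, 1 + j * N + b} \<omega> - dens) *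
      A (pat r (w a 0) \<omega>) * B (pat r (w 0 b) \<omega>)" by (simp add: \<Phi>_def)
  qed
  let ?e = "expectation (\<lambda>\<omega>. \<Phi> (pat r u \<omega>))"
  have "\<bar>\<Sum>a<N. \<Sum>b<N. expectation (\<lambda>\<omega>. \<Phi> (pat r (w a b) \<omega>))\<bar> \<le> (9 / 4) * \<tau> * (real N)^2"
  proof -
    have "(\<Sum>a<N. \<Sum>b<N. expectation (\<lambda>\<omega>. \<Phi> (pat r (w a b) \<omega>))) =
      (\<Sum>a<N. \<Sum>b<N. expectation (\<lambda>\<omega>. (X {1 + i * N + a, 1 + j * N + b} \<omega> - dens) *
        A (pat r (w a 0) \<omega>) * B (pat r (w 0 b) \<omega>)))"
      by (intro sum.cong refl eq) auto
    moreover have "\<bar>\<dots>\<bar> \<le> (9 / 4) * \<tau> * (real N)^2"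
      using pat_fun_measurable[OF w] A(2) B(2) N_pos by (intro bipartite_decorrelation[OF l]) auto
    ultimately show ?thesis by simp
  qed
  \<comment> \<open>Each of the \<open>N\<^sup>2\<close> summands agrees with the correlation along
    \<open>u\<close> up to \<open>2 * \<eta>\<close>; thus a bound on the sum becomes a bound on one
    correlation.\<close>
  moreover have "\<bar>(\<Sum>a<N. \<Sum>b<N. ?e) - (\<Sum>a<N. \<Sum>b<N. expectation (\<lambda>\<omega>. \<Phi> (pat r (w a b) \<omega>)))\<bar> \<le> (\<Sum>a<N. \<Sum>b<N. 2 * \<eta>)"
    unfolding sum_subtractf[symmetric]
    using spread_transfer_abs[OF u w] \<Phi>1 ij
    by (intro order_trans[OF sum_abs] sum_mono) auto
  ultimately have "\<bar>\<Sum>a<N. \<Sum>b<N. ?e\<bar> \<le> (9 / 4) * \<tau> * (real N)^2 + (\<Sum>a<N. \<Sum>b<N. 2 * \<eta>)" by linarith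
  hence "(real N)^2 * \<bar>?e\<bar> \<le> (real N)^2 * ((9 / 4) * \<tau> + 2 * \<eta>)"
    by (simp add: power2_eq_square abs_mult algebra_simps)
  hence "\<bar>?e\<bar> \<le> (9 / 4) * \<tau> + 2 * \<eta>" using N_pos by simp
  \<comment> \<open>From \<open>14 * \<eta> \<le> \<tau>\<close> the total is at most
    \<open>9 / 4 + 1 / 7\<close> times \<tau>.\<close>
  also have "\<dots> \<le> 3 * \<tau>"
  proof -
    have "\<tau> ^ 8 \<le> \<tau> ^ 1" using \<tau> by (intro power_decreasing) auto
    moreover have "3 / real N \<ge> 0" by simp
    ultimately have "14 * \<eta> \<le> \<tau>" using \<tau>(3) by (simp only: power_one_right)
    thus ?thesis using \<tau>(1) by linarith
  qed
  finally show ?thesis unfolding \<Phi>_def .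
qed

section \<open>Cylinder events, and peeling off their edges\<close>

definition cyl :: "nat set set \<Rightarrow> nat set set \<Rightarrow> nat set set \<Rightarrow> real" where
  "cyl F Z z = (\<Prod>t\<in>F. of_bool (t \<in> Z \<longleftrightarrow> t \<in> z))"

text \<open>The probability of the cylinder in the Erdos--Renyi graph of density
  \<open>dens\<close>. Both it and \<open>cyl\<close> are products over \<open>F\<close>, so that
  edges can be removed singly.\<close>

definition cyl_weight :: "nat set set \<Rightarrow> nat set set \<Rightarrow> real" where
  "cyl_weight F Z = (\<Prod>t\<in>F. if t \<in> Z then dens else 1 - dens)"

lemma cyl_bounds: "0 \<le> cyl F Z z" "cyl F Z z \<le> 1" "\<bar>cyl F Z z\<bar> \<le> 1"
proof -
  show "0 \<le> cyl F Z z" "cyl F Z z \<le> 1" unfolding cyl_def by (auto intro!: prod_nonneg prod_le_1)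
  thus "\<bar>cyl F Z z\<bar> \<le> 1" by simp
qed

text \<open>Induction on \<open>F\<close>: the indicator of one edge is a constant plus a signed
  centred indicator, and the centred part costs \<open>3 * \<tau>\<close>. Taking \<open>H\<close>
  constant 1 gives the probability of the cylinder itself.\<close>

lemma cylinder_decoupling:
  assumes u: "emb r u" and r1: "r1 \<le> r" and rN: "r * N \<le> n"
    and H: "\<And>z z'. z \<inter> binom {r1..<r} 2 = z' \<inter> binom {r1..<r} 2 \<Longrightarrow> H z = H z'" "\<And>z. \<bar>H z\<bar> \<le> 1"
    and F: "F \<subseteq> binom {0..<r1} 2"
  shows "\<bar>expectation (\<lambda>\<omega>. cyl F Z (pat r u \<omega>) * H (pat r u \<omega>)) - cyl_weight F Z * expectation (\<lambda>\<omega>. H (pat r u \<omega>))\<bar>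
    \<le> card F * (3 * \<tau>)"
proof -
  have "finite F" using F finite_binom finite_subset by blast
  thus ?thesis using F
  proof (induction F rule: finite_induct)
    case empty
    thus ?case by (simp add: cyl_def cyl_weight_def)
  next
    case (insert s F)
    obtain i j where s: "s = {i, j}" "i < j" "j < r1"
    proof -
      have "s \<subseteq> {0..<r1}" "card s = 2" using insert.prems by (auto simp: binom_def)
      then obtain x y where "s = {x, y}" "x \<noteq> y" "x < r1" "y < r1" by (auto simp: card_2_iff)
      thus ?thesis using that[of x y] that[of y x] by (cases "x < y") (auto simp: insert_commute)
    qed
    \<comment> \<open>\<open>H\<close> and the edges avoiding \<open>j\<close> form the factor blind
      to \<open>j\<close>. The other edges contain \<open>j\<close> and hence avoid
      \<open>i\<close>: an edge with both ends is \<open>s\<close>, which is not in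
      \<open>F\<close>.\<close>
    let ?F1 = "{t \<in> F. j \<notin> t}" and ?F2 = "{t \<in> F. j \<in> t}"
    let ?A = "\<lambda>z. cyl ?F1 Z z * H z" and ?B = "\<lambda>z. cyl ?F2 Z z"
    let ?Y = "\<lambda>\<omega>. (of_bool ({i, j} \<in> pat r u \<omega>) - dens) * ?A (pat r u \<omega>) * ?B (pat r u \<omega>)"
    have split: "cyl F Z z = cyl ?F1 Z z * cyl ?F2 Z z" for z
      unfolding cyl_def using insert.hyps(1)
      by (subst prod.union_disjoint[symmetric]) (auto intro!: prod.cong)
    have step: "\<bar>expectation ?Y\<bar> \<le> 3 * \<tau>"
    proof (rule edge_decorrelation[OF u s(2) _ rN])
      show "j < r" using s r1 by simp
      show "?A z = ?A z'" if "\<And>t. j \<notin> t \<Longrightarrow> t \<in> z \<longleftrightarrow> t \<in> z'" for z z'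
      proof -
        have "j \<notin> t" if "t \<in> binom {r1..<r} 2" for t using that s by (auto simp: binom_def)
        hence "H z = H z'" using that by (intro H(1)) blast
        moreover have "cyl ?F1 Z z = cyl ?F1 Z z'" unfolding cyl_def using that by (intro prod.cong) auto
        ultimately show ?thesis by simp
      qed
      show "\<bar>?A z\<bar> \<le> 1" for z using H(2) cyl_bounds by (intro abs_mult_le_one)
      show "?B z = ?B z'" if *: "\<And>t. i \<notin> t \<Longrightarrow> t \<in> z \<longleftrightarrow> t \<in> z'" for z z'
        unfolding cyl_def
      proof (rule prod.cong[OF refl])
        fix t assume t: "t \<in> ?F2"
        have "i \<notin> t"
        proof
          assume "i \<in> t"
          hence "{i, j} \<subseteq> t" "card t = 2" using t insert.prems by (auto simp: binom_def)
          moreover have "finite t" using \<open>card t = 2\<close> card.infinite by fastforce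
          ultimately have "{i, j} = t" using s(2) by (intro card_subset_eq) auto
          thus False using t insert.hyps s by auto
        qed
        thus "of_bool ((t \<in> Z) = (t \<in> z)) = of_bool ((t \<in> Z) = (t \<in> z'))" using * by simp
      qed
      show "\<bar>?B z\<bar> \<le> 1" for z by (rule cyl_bounds)
    qed
    \<comment> \<open>Presence of \<open>s\<close> has indicator \<open>(1 - dens) + dens\<close> or
      \<open>0\<close>, absence the complement; \<sigma> and \<pi> are the coefficients when this is
      written through the centred indicator of \<open>s\<close>.\<close>
    define \<sigma> :: real where "\<sigma> = (if s \<in> Z then 1 else -1)"
    define \<pi> where "\<pi> = (if s \<in> Z then dens else 1 - dens)"
    have \<sigma>\<pi>: "\<bar>\<sigma>\<bar> \<le> 1" "\<bar>\<pi>\<bar> \<le> 1" using dens_bounds by (auto simp: \<sigma>_def \<pi>_def)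
    have m: "(\<lambda>\<omega>. \<Psi> (pat r u \<omega>)) \<in> borel_measurable M" for \<Psi> :: "nat set set \<Rightarrow> real"
      by (rule pat_fun_measurable[OF u])
    have i1: "integrable M ?Y"
    proof (rule integrable_bounded[of _ 1])
      show "?Y \<in> borel_measurable M" by (rule m)
      show "\<bar>?Y \<omega>\<bar> \<le> 1" for \<omega>
      proof -
        have "\<bar>of_bool ({i, j} \<in> pat r u \<omega>) - dens\<bar> \<le> 1" using dens_bounds by auto
        thus ?thesis using H(2) cyl_bounds by (intro abs_mult_le_one)
      qed
    qed
    have i2: "integrable M (\<lambda>\<omega>. cyl F Z (pat r u \<omega>) * H (pat r u \<omega>))"
      using m[of "\<lambda>z. cyl F Z z * H z"] H(2) cyl_bounds
      by (intro integrable_bounded[of _ 1] abs_mult_le_one) auto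
    have "cyl (insert s F) Z z * H z = \<sigma> * ((of_bool ({i, j} \<in> z) - dens) * ?A z * ?B z) + \<pi> * (cyl F Z z * H z)" for z
    proof -
      have "cyl (insert s F) Z z = of_bool (s \<in> Z \<longleftrightarrow> s \<in> z) * cyl F Z z"
        unfolding cyl_def using insert.hyps by simp
      thus ?thesis unfolding split \<sigma>_def \<pi>_def s(1) by (auto simp: algebra_simps)
    qed
    hence "expectation (\<lambda>\<omega>. cyl (insert s F) Z (pat r u \<omega>) * H (pat r u \<omega>)) =
      \<sigma> * expectation ?Y + \<pi> * expectation (\<lambda>\<omega>. cyl F Z (pat r u \<omega>) * H (pat r u \<omega>))"
      using i1 i2 by simp
    moreover have "cyl_weight (insert s F) Z = \<pi> * cyl_weight F Z"
      unfolding cyl_weight_def \<pi>_def using insert.hyps by simp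
    ultimately have "expectation (\<lambda>\<omega>. cyl (insert s F) Z (pat r u \<omega>) * H (pat r u \<omega>))
        - cyl_weight (insert s F) Z * expectation (\<lambda>\<omega>. H (pat r u \<omega>)) =
      \<sigma> * expectation ?Y + \<pi> * (expectation (\<lambda>\<omega>. cyl F Z (pat r u \<omega>) * H (pat r u \<omega>))
        - cyl_weight F Z * expectation (\<lambda>\<omega>. H (pat r u \<omega>)))"
      by (simp add: algebra_simps)
    also have "\<bar>\<dots>\<bar> \<le> 3 * \<tau> + card F * (3 * \<tau>)"
    proof (rule abs_combination_le[OF \<sigma>\<pi> step])
      show "\<bar>expectation (\<lambda>\<omega>. cyl F Z (pat r u \<omega>) * H (pat r u \<omega>))
        - cyl_weight F Z * expectation (\<lambda>\<omega>. H (pat r u \<omega>))\<bar> \<le> card F * (3 * \<tau>)"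
        using insert.IH insert.prems by simp
    qed
    also have "\<dots> = card (insert s F) * (3 * \<tau>)" using insert.hyps by (simp add: algebra_simps)
    finally show ?case .
  qed
qed

text \<open>Expand \<open>G\<close> over the \<open>2 ^ (r1 choose 2)\<close> cylinders on the first
  block. For each one, both the joint expectation and the probability are compared with the same
  \<open>cyl_weight\<close>, which turns \<open>3 * \<tau>\<close> per edge into
  \<open>6 * \<tau>\<close>.\<close>

lemma pattern_covariance:
  assumes u: "emb r u" and r1: "r1 \<le> r" and rN: "r * N \<le> n"
    and G: "\<And>z z'. z \<inter> binom {0..<r1} 2 = z' \<inter> binom {0..<r1} 2 \<Longrightarrow> G z = G z'" "\<And>z. \<bar>G z\<bar> \<le> 1"
    and H: "\<And>z z'. z \<inter> binom {r1..<r} 2 = z' \<inter> binom {r1..<r} 2 \<Longrightarrow> H z = H z'" "\<And>z. \<bar>H z\<bar> \<le> 1"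
  shows "\<bar>expectation (\<lambda>\<omega>. G (pat r u \<omega>) * H (pat r u \<omega>)) - expectation (\<lambda>\<omega>. G (pat r u \<omega>)) * expectation (\<lambda>\<omega>. H (pat r u \<omega>))\<bar>
    \<le> 2 ^ (r1 choose 2) * (6 * (r1 choose 2) * \<tau>)"
proof -
  let ?E = "binom {0..<r1} 2"
  have fE: "finite ?E" by (simp add: finite_binom)
  have cE: "card ?E = r1 choose 2" unfolding binom_def by (subst n_subsets) auto
  have m: "(\<lambda>\<omega>. \<Psi> (pat r u \<omega>)) \<in> borel_measurable M" for \<Psi> :: "nat set set \<Rightarrow> real"
    by (rule pat_fun_measurable[OF u])
  have i1: "integrable M (\<lambda>\<omega>. cyl ?E Z (pat r u \<omega>) * H (pat r u \<omega>))" for Z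
    using m[of "\<lambda>z. cyl ?E Z z * H z"] H(2) cyl_bounds
    by (intro integrable_bounded[of _ 1] abs_mult_le_one) auto
  have i2: "integrable M (\<lambda>\<omega>. cyl ?E Z (pat r u \<omega>))" for Z
    using m[of "\<lambda>z. cyl ?E Z z"] cyl_bounds by (intro integrable_bounded[of _ 1]) auto
  have cylE: "cyl ?E Z z = of_bool (Z = z \<inter> ?E)" if "Z \<in> Pow ?E" for Z z
  proof -
    have "cyl ?E Z z = of_bool (\<forall>t\<in>?E. t \<in> Z \<longleftrightarrow> t \<in> z)"
      unfolding cyl_def by (rule prod_of_bool[OF fE])
    also have "(\<forall>t\<in>?E. t \<in> Z \<longleftrightarrow> t \<in> z) \<longleftrightarrow> Z = z \<inter> ?E" using that by auto
    finally show ?thesis .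
  qed
  have Gz: "G z = (\<Sum>Z\<in>Pow ?E. G Z * cyl ?E Z z)" for z
  proof -
    have "(\<Sum>Z\<in>Pow ?E. G Z * cyl ?E Z z) = (\<Sum>Z\<in>Pow ?E. if Z = z \<inter> ?E then G Z else 0)"
      using cylE by (intro sum.cong) auto
    also have "\<dots> = G (z \<inter> ?E)" using fE by simp
    also have "\<dots> = G z" by (rule G(1)) auto
    finally show ?thesis by simp
  qed
  have "expectation (\<lambda>\<omega>. G (pat r u \<omega>) * H (pat r u \<omega>)) =
      expectation (\<lambda>\<omega>. \<Sum>Z\<in>Pow ?E. G Z * (cyl ?E Z (pat r u \<omega>) * H (pat r u \<omega>)))"
    by (subst Gz) (simp add: sum_distrib_right mult.assoc)
  also have "\<dots> = (\<Sum>Z\<in>Pow ?E. G Z * expectation (\<lambda>\<omega>. cyl ?E Z (pat r u \<omega>) * H (pat r u \<omega>)))"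
    using i1 by (subst Bochner_Integration.integral_sum) auto
  finally have GH: "expectation (\<lambda>\<omega>. G (pat r u \<omega>) * H (pat r u \<omega>)) = \<dots>" .
  have "expectation (\<lambda>\<omega>. G (pat r u \<omega>)) = expectation (\<lambda>\<omega>. \<Sum>Z\<in>Pow ?E. G Z * cyl ?E Z (pat r u \<omega>))"
    by (subst Gz) simp
  also have "\<dots> = (\<Sum>Z\<in>Pow ?E. G Z * expectation (\<lambda>\<omega>. cyl ?E Z (pat r u \<omega>)))"
    using i2 by (subst Bochner_Integration.integral_sum) auto
  finally have G': "expectation (\<lambda>\<omega>. G (pat r u \<omega>)) = \<dots>" .
  let ?h = "expectation (\<lambda>\<omega>. H (pat r u \<omega>))"
  have h1: "\<bar>?h\<bar> \<le> 1" using expectation_abs_le[OF m[of H], of 1] H(2) by simp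
  have t: "\<bar>G Z * (expectation (\<lambda>\<omega>. cyl ?E Z (pat r u \<omega>) * H (pat r u \<omega>)) - expectation (\<lambda>\<omega>. cyl ?E Z (pat r u \<omega>)) * ?h)\<bar>
      \<le> 6 * (r1 choose 2) * \<tau>" for Z
  proof -
    have a: "\<bar>expectation (\<lambda>\<omega>. cyl ?E Z (pat r u \<omega>) * H (pat r u \<omega>)) - cyl_weight ?E Z * ?h\<bar> \<le> (r1 choose 2) * (3 * \<tau>)"
      using cylinder_decoupling[OF u r1 rN, of H ?E Z] H unfolding cE by blast
    have b: "\<bar>expectation (\<lambda>\<omega>. cyl ?E Z (pat r u \<omega>)) - cyl_weight ?E Z\<bar> \<le> (r1 choose 2) * (3 * \<tau>)"
      using cylinder_decoupling[OF u r1 rN, of "\<lambda>_. 1" ?E Z] unfolding cE by (simp add: prob_space)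
    have "\<bar>(expectation (\<lambda>\<omega>. cyl ?E Z (pat r u \<omega>)) - cyl_weight ?E Z) * ?h\<bar> \<le> \<bar>expectation (\<lambda>\<omega>. cyl ?E Z (pat r u \<omega>)) - cyl_weight ?E Z\<bar>"
      unfolding abs_mult using h1 by (intro mult_left_le) auto
    hence "\<bar>expectation (\<lambda>\<omega>. cyl ?E Z (pat r u \<omega>) * H (pat r u \<omega>)) - expectation (\<lambda>\<omega>. cyl ?E Z (pat r u \<omega>)) * ?h\<bar> \<le> 6 * (r1 choose 2) * \<tau>"
      using a b by (simp add: algebra_simps)
    moreover have "\<bar>G Z * x\<bar> \<le> \<bar>x\<bar>" for x
      unfolding abs_mult using G(2) by (intro mult_left_le_one_le) auto
    ultimately show ?thesis using order_trans by blast
  qed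
  have "\<bar>expectation (\<lambda>\<omega>. G (pat r u \<omega>) * H (pat r u \<omega>)) - expectation (\<lambda>\<omega>. G (pat r u \<omega>)) * ?h\<bar>
      = \<bar>\<Sum>Z\<in>Pow ?E. G Z * (expectation (\<lambda>\<omega>. cyl ?E Z (pat r u \<omega>) * H (pat r u \<omega>)) - expectation (\<lambda>\<omega>. cyl ?E Z (pat r u \<omega>)) * ?h)\<bar>"
    unfolding GH G' by (simp add: sum_distrib_right right_diff_distrib sum_subtractf mult.assoc)
  also have "\<dots> \<le> (\<Sum>Z\<in>Pow ?E. 6 * (r1 choose 2) * \<tau>)"
    by (rule order_trans[OF sum_abs sum_mono]) (rule t)
  also have "\<dots> = 2 ^ (r1 choose 2) * (6 * (r1 choose 2) * \<tau>)"
    using fE by (simp add: card_Pow cE)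
  finally show ?thesis .
qed

text \<open>Both functions are pulled back to one pattern on \<open>card J + card J'\<close>
  vertices, the first block being an initial segment. The condition \<open>2 * k * N \<le> n\<close>
  leaves room for gaps of length \<open>N\<close> between these vertices.\<close>

lemma determined_covariance:
  assumes J: "J \<subseteq> {1..n}" "J' \<subseteq> {1..n}" "\<And>x y. x \<in> J \<Longrightarrow> y \<in> J' \<Longrightarrow> x < y"
    and k: "card J \<le> k" "card J' \<le> k" "2 * k * N \<le> n"
    and g: "determined J g" "\<And>\<omega>. \<bar>g \<omega>\<bar> \<le> 1" and h: "determined J' h" "\<And>\<omega>. \<bar>h \<omega>\<bar> \<le> 1"
  shows "\<bar>expectation (\<lambda>\<omega>. g \<omega> * h \<omega>) - expectation g * expectation h\<bar> \<le> 2 ^ (k choose 2) * (6 * (k choose 2) * \<tau>)"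
proof -
  have fin: "finite J" "finite J'" by (rule finite_subset[OF _ finite_atLeastAtMost], rule J)+
  define r1 where "r1 = card J"
  define r where "r = card J + card J'"
  \<comment> \<open>Sorted because all of \<open>J\<close> lies to the left of
    \<open>J'\<close>.\<close>
  define xs where "xs = sorted_list_of_set J @ sorted_list_of_set J'"
  define u where "u = (!) xs"
  have len: "length xs = r" by (simp add: xs_def r_def)
  have u: "emb r u" unfolding u_def
    using J fin len by (intro emb_list) (auto simp: xs_def sorted_wrt_append)
  have uJ: "u ` {0..<r1} = J"
  proof -
    have "u ` {0..<r1} = (!) (sorted_list_of_set J) ` {0..<length (sorted_list_of_set J)}"
      by (intro image_cong) (auto simp: u_def xs_def nth_append r1_def)
    also have "\<dots> = J" using fin by (simp add: nth_image)
    finally show ?thesis .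
  qed
  have uJ': "u ` {r1..<r} = J'"
  proof -
    have "{r1..<r} = (\<lambda>i. i + r1) ` {0..<card J'}"
      by (subst image_add_atLeastLessThan') (simp add: r_def r1_def add.commute)
    hence "u ` {r1..<r} = (\<lambda>i. u (i + r1)) ` {0..<card J'}" by (simp only: image_image)
    also have "\<dots> = (!) (sorted_list_of_set J') ` {0..<length (sorted_list_of_set J')}"
      by (intro image_cong) (auto simp: u_def xs_def nth_append r1_def)
    also have "\<dots> = J'" using fin by (simp add: nth_image)
    finally show ?thesis .
  qed
  have sub: "{0..<r1} \<subseteq> {0..<r}" "{r1..<r} \<subseteq> {0..<r}" by (auto simp: r_def r1_def)
  have det: "determined (u ` {0..<r1}) g" "determined (u ` {r1..<r}) h" using g(1) h(1) uJ uJ' by simp_all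
  obtain G where G: "\<And>z. \<bar>G z\<bar> \<le> 1" "\<And>z z'. z \<inter> binom {0..<r1} 2 = z' \<inter> binom {0..<r1} 2 \<Longrightarrow> G z = G z'"
    "\<And>\<omega>. \<omega> \<in> space M \<Longrightarrow> g \<omega> = G (pat r u \<omega>)"
    by (rule determined_pattern[OF u sub(1) det(1) g(2)]) (rule that)
  obtain H where H: "\<And>z. \<bar>H z\<bar> \<le> 1" "\<And>z z'. z \<inter> binom {r1..<r} 2 = z' \<inter> binom {r1..<r} 2 \<Longrightarrow> H z = H z'"
    "\<And>\<omega>. \<omega> \<in> space M \<Longrightarrow> h \<omega> = H (pat r u \<omega>)"
    by (rule determined_pattern[OF u sub(2) det(2) h(2)]) (rule that)
  have rN: "r * N \<le> n"
  proof -
    have "r \<le> 2 * k" unfolding r_def using k(1,2) by linarith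
    hence "r * N \<le> (2 * k) * N" by (rule mult_le_mono1)
    thus ?thesis using k(3) by (rule order_trans)
  qed
  have "\<bar>expectation (\<lambda>\<omega>. g \<omega> * h \<omega>) - expectation g * expectation h\<bar> =
    \<bar>expectation (\<lambda>\<omega>. G (pat r u \<omega>) * H (pat r u \<omega>)) - expectation (\<lambda>\<omega>. G (pat r u \<omega>)) * expectation (\<lambda>\<omega>. H (pat r u \<omega>))\<bar>"
    using G(3) H(3) by (simp cong: Bochner_Integration.integral_cong)
  also have "\<dots> \<le> 2 ^ (r1 choose 2) * (6 * (r1 choose 2) * \<tau>)"
    by (rule pattern_covariance[OF u _ rN G(2,1) H(2,1)]) (simp add: r_def r1_def)
  also have "\<dots> \<le> 2 ^ (k choose 2) * (6 * (k choose 2) * \<tau>)"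
  proof -
    have "r1 choose 2 \<le> k choose 2"
      unfolding r1_def using k(1) by (rule binomial_right_mono)
    thus ?thesis using \<tau> by (intro mult_mono power_increasing mult_right_mono mult_left_mono) auto
  qed
  finally show ?thesis .
qed

section \<open>Sums of test functions over consecutive blocks\<close>

lemma variance_block_sum:
  fixes m :: nat
  assumes J: "\<And>l. l < m \<Longrightarrow> J l \<subseteq> {1..n}" "\<And>l. l < m \<Longrightarrow> card (J l) \<le> k"
    and sep: "\<And>l l' x y. l < l' \<Longrightarrow> l' < m \<Longrightarrow> x \<in> J l \<Longrightarrow> y \<in> J l' \<Longrightarrow> x < y"
    and k: "2 * k * N \<le> n"
    and h: "\<And>l. l < m \<Longrightarrow> determined (J l) (h l)" "\<And>l \<omega>. l < m \<Longrightarrow> \<bar>h l \<omega>\<bar> \<le> 1"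
  shows "expectation (\<lambda>\<omega>. (\<Sum>l<m. h l \<omega> - expectation (h l))\<^sup>2) \<le> m + m^2 * (2 ^ (k choose 2) * (6 * (k choose 2) * \<tau>))"
proof -
  define \<delta> where "\<delta> = 2 ^ (k choose 2) * (6 * (k choose 2) * \<tau>)"
  have \<delta>: "\<delta> \<ge> 0" using \<tau> by (simp add: \<delta>_def)
  have hm: "h l \<in> borel_measurable M" if "l < m" for l
    using determined_measurable[OF h(1) J(1)] that by auto
  have hi: "integrable M (h l)" if "l < m" for l
    using hm[OF that] h(2)[OF that] by (rule integrable_bounded)
  have hhi: "integrable M (\<lambda>\<omega>. h l \<omega> * h l' \<omega>)" if "l < m" "l' < m" for l l'
    using hm[OF that(1)] hm[OF that(2)] h(2)[OF that(1)] h(2)[OF that(2)]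
    by (intro integrable_bounded[of _ 1] abs_mult_le_one borel_measurable_times)
  have cov: "expectation (\<lambda>\<omega>. h l \<omega> * h l' \<omega>) - expectation (h l) * expectation (h l') \<le> (if l = l' then 1 else 0) + \<delta>"
    if l: "l < m" "l' < m" for l l'
  proof -
    consider "l = l'" | "l < l'" | "l' < l" by linarith
    thus ?thesis
    proof cases
      case 1
      have "expectation (\<lambda>\<omega>. h l \<omega> * h l \<omega>) \<le> 1"
      proof (rule order_trans[OF abs_ge_self expectation_abs_le])
        show "(\<lambda>\<omega>. h l \<omega> * h l \<omega>) \<in> borel_measurable M" using hm[OF l(1)] by simp
        show "\<bar>h l \<omega> * h l \<omega>\<bar> \<le> 1" for \<omega> using h(2)[OF l(1)] by (intro abs_mult_le_one)
      qed
      hence "expectation (\<lambda>\<omega>. h l \<omega> * h l \<omega>) - expectation (h l) * expectation (h l) \<le> 1 + \<delta>"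
        using \<delta> zero_le_square[of "expectation (h l)"] by linarith
      thus ?thesis using 1 by simp
    next
      case 2
      have "\<bar>expectation (\<lambda>\<omega>. h l \<omega> * h l' \<omega>) - expectation (h l) * expectation (h l')\<bar> \<le> \<delta>"
        unfolding \<delta>_def using J[OF l(1)] J[OF l(2)] sep[OF 2 l(2)] k h(1)[OF l(1)] h(1)[OF l(2)] h(2)[OF l(1)] h(2)[OF l(2)]
        by (intro determined_covariance)
      thus ?thesis using 2 by simp
    next
      case 3
      have "\<bar>expectation (\<lambda>\<omega>. h l' \<omega> * h l \<omega>) - expectation (h l') * expectation (h l)\<bar> \<le> \<delta>"
        unfolding \<delta>_def using J[OF l(1)] J[OF l(2)] sep[OF 3 l(1)] k h(1)[OF l(1)] h(1)[OF l(2)] h(2)[OF l(1)] h(2)[OF l(2)]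
        by (intro determined_covariance)
      thus ?thesis using 3 by (simp add: mult.commute)
    qed
  qed
  have "expectation (\<lambda>\<omega>. (\<Sum>l<m. h l \<omega> - expectation (h l))\<^sup>2) =
    expectation (\<lambda>\<omega>. \<Sum>l<m. \<Sum>l'<m. (h l \<omega> - expectation (h l)) * (h l' \<omega> - expectation (h l')))"
    by (simp add: power2_eq_square sum_product)
  also have "\<dots> = (\<Sum>l<m. \<Sum>l'<m. expectation (\<lambda>\<omega>. (h l \<omega> - expectation (h l)) * (h l' \<omega> - expectation (h l'))))"
  proof -
    have i: "integrable M (\<lambda>\<omega>. (h l \<omega> - expectation (h l)) * (h l' \<omega> - expectation (h l')))" if "l < m" "l' < m" for l l'
      using hi[OF that(1)] hi[OF that(2)] hhi[OF that] by (simp add: algebra_simps)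
    have "integrable M (\<lambda>\<omega>. \<Sum>l'<m. (h l \<omega> - expectation (h l)) * (h l' \<omega> - expectation (h l')))" if "l < m" for l
      using i that by (intro Bochner_Integration.integrable_sum) auto
    thus ?thesis using i by (simp add: Bochner_Integration.integral_sum)
  qed
  also have "\<dots> = (\<Sum>l<m. \<Sum>l'<m. expectation (\<lambda>\<omega>. h l \<omega> * h l' \<omega>) - expectation (h l) * expectation (h l'))"
    using hi hhi by (intro sum.cong refl) (simp add: algebra_simps prob_space)
  also have "\<dots> \<le> (\<Sum>l<m. \<Sum>l'<m. (if l = l' then 1 else 0) + \<delta>)"
    using cov by (intro sum_mono) auto
  also have "\<dots> = m + m^2 * \<delta>" by (simp add: sum.distrib power2_eq_square algebra_simps)
  finally show ?thesis unfolding \<delta>_def .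
qed

text \<open>\<open>K\<close> is the solution of
  \<open>K powr (1 - p) = \<epsilon>\<^sup>2 / 8\<close>, and its second condition keeps
  \<open>K\<^sup>2\<close> times the variance bound below the square of
  \<open>m * \<epsilon>\<^sup>2 / 2\<close>.\<close>

lemma concentration_on_some_block:
  fixes F :: "'a \<Rightarrow> real" and m k :: nat
  assumes F: "determined {1..n} F" "expectation F = 0" "expectation (\<lambda>\<omega>. \<bar>F \<omega>\<bar> powr p) = 1"
    and p: "1 < p" and \<epsilon>: "0 < \<epsilon>" and m: "0 < m" "m * k \<le> n" and k: "2 * k * N \<le> n"
    and K: "K = (8 / \<epsilon>\<^sup>2) powr (1 / (p - 1))"
      "K\<^sup>2 * (m + m^2 * (2 ^ (k choose 2) * (6 * (k choose 2) * \<tau>))) \<le> m^2 * (\<epsilon> ^ 4 / 4)"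
  shows "\<exists>l<m. \<forall>J. J \<subseteq> {1 + l * k..<1 + l * k + k} \<longrightarrow>
    1 - \<epsilon> \<le> measure M {\<omega> \<in> space M. \<bar>real_cond_exp M (gen_sigma M X 2 J) F \<omega>\<bar> \<le> \<epsilon>}"
proof (rule ccontr)
  assume "\<not> ?thesis"
  hence "\<forall>l. \<exists>J. l < m \<longrightarrow> J \<subseteq> {1 + l * k..<1 + l * k + k} \<and>
    measure M {\<omega> \<in> space M. \<bar>real_cond_exp M (gen_sigma M X 2 J) F \<omega>\<bar> \<le> \<epsilon>} < 1 - \<epsilon>"
    by (meson not_le)
  then obtain J where J: "\<And>l. l < m \<Longrightarrow> J l \<subseteq> {1 + l * k..<1 + l * k + k}"
    and fail: "\<And>l. l < m \<Longrightarrow>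
      measure M {\<omega> \<in> space M. \<bar>real_cond_exp M (gen_sigma M X 2 (J l)) F \<omega>\<bar> \<le> \<epsilon>} < 1 - \<epsilon>"
    by metis
  have block: "l * k + k \<le> n" if "l < m" for l
  proof -
    have "Suc l * k \<le> m * k" using that by (intro mult_right_mono) auto
    thus ?thesis using m(2) by simp
  qed
  have Jn: "J l \<subseteq> {1..n}" if "l < m" for l using J[OF that] block[OF that] by fastforce
  have Jk: "card (J l) \<le> k" if "l < m" for l using card_mono[OF _ J[OF that]] by simp
  have Fm: "F \<in> borel_measurable M" by (rule determined_measurable[OF F(1)]) simp
  obtain B where B: "\<And>\<omega>. \<omega> \<in> space M \<Longrightarrow> \<bar>F \<omega>\<bar> \<le> B" using determined_bounded[OF F(1)] by blast
  have "\<exists>h. determined (J l) h \<and> (\<forall>\<omega>. \<bar>h \<omega>\<bar> \<le> 1) \<and> \<epsilon>\<^sup>2 \<le> expectation (\<lambda>\<omega>. h \<omega> * F \<omega>)" if "l < m" for l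
    using test_function[OF Jn[OF that] Fm B \<epsilon> fail[OF that]] by metis
  then obtain h where h: "\<And>l. l < m \<Longrightarrow> determined (J l) (h l)" "\<And>l \<omega>. l < m \<Longrightarrow> \<bar>h l \<omega>\<bar> \<le> 1"
      "\<And>l. l < m \<Longrightarrow> \<epsilon>\<^sup>2 \<le> expectation (\<lambda>\<omega>. h l \<omega> * F \<omega>)"
    by metis
  have hm: "h l \<in> borel_measurable M" if "l < m" for l
    using determined_measurable[OF h(1) Jn] that by auto
  have Eh: "\<bar>expectation (h l)\<bar> \<le> 1" if "l < m" for l
    using expectation_abs_le[OF hm[OF that]] h(2)[OF that] by auto
  define S where "S = (\<lambda>\<omega>. \<Sum>l<m. h l \<omega> - expectation (h l))"
  have Sm: "S \<in> borel_measurable M"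
    unfolding S_def using hm by (intro borel_measurable_sum borel_measurable_diff) auto
  have Sb: "\<bar>S \<omega>\<bar> \<le> 2 * m" for \<omega>
  proof -
    have "\<bar>S \<omega>\<bar> \<le> (\<Sum>l<m. \<bar>h l \<omega> - expectation (h l)\<bar>)" unfolding S_def by (rule sum_abs)
    also have "\<dots> \<le> (\<Sum>l<m. 2)"
    proof (rule sum_mono)
      fix l assume "l \<in> {..<m}"
      thus "\<bar>h l \<omega> - expectation (h l)\<bar> \<le> 2" using h(2)[of l \<omega>] Eh[of l] by auto
    qed
    finally show ?thesis by simp
  qed
  have S2: "expectation (\<lambda>\<omega>. (S \<omega>)\<^sup>2) \<le> m + m^2 * (2 ^ (k choose 2) * (6 * (k choose 2) * \<tau>))"
    unfolding S_def
  proof (rule variance_block_sum[OF Jn Jk _ k h(1,2)])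
    fix l l' x y assume l: "l < l'" "l' < m" "x \<in> J l" "y \<in> J l'"
    have "Suc l * k \<le> l' * k" using l by (intro mult_right_mono) auto
    moreover have "x < 1 + l * k + k" "1 + l' * k \<le> y" using l J[of l] J[of l'] by fastforce+
    ultimately show "x < y" by simp
  qed
  have iF: "integrable M F" using Fm B by (rule integrable_bounded)
  have "\<bar>h l \<omega> * F \<omega>\<bar> \<le> B" if "l < m" "\<omega> \<in> space M" for l \<omega>
    using h(2)[OF that(1), of \<omega>] B[OF that(2)] unfolding abs_mult
    by (intro order_trans[OF mult_left_le_one_le]) auto
  hence ihF: "integrable M (\<lambda>\<omega>. h l \<omega> * F \<omega>)" if "l < m" for l
    using hm[OF that] Fm that by (intro integrable_bounded[of _ B]) auto
  have "m * \<epsilon>\<^sup>2 = (\<Sum>l<m. \<epsilon>\<^sup>2)" by simp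
  also have "\<dots> \<le> (\<Sum>l<m. expectation (\<lambda>\<omega>. h l \<omega> * F \<omega>))" using h(3) by (intro sum_mono) auto
  \<comment> \<open>Centring \<open>h l\<close> is free because \<open>F\<close> has mean
    zero.\<close>
  also have "\<dots> = (\<Sum>l<m. expectation (\<lambda>\<omega>. (h l \<omega> - expectation (h l)) * F \<omega>))"
    using ihF iF F(2) by (intro sum.cong refl) (simp add: left_diff_distrib)
  also have "\<dots> = expectation (\<lambda>\<omega>. S \<omega> * F \<omega>)"
    unfolding S_def sum_distrib_right using ihF iF
    by (subst Bochner_Integration.integral_sum) (auto simp: left_diff_distrib)
  also have "\<dots> \<le> K * expectation (\<lambda>\<omega>. \<bar>S \<omega>\<bar>) + (2 * m) * K powr (1 - p)"
    using p \<epsilon> Fm B F(3) Sm Sb by (intro truncated_duality) (auto simp: K(1))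
  also have "K powr (1 - p) = \<epsilon>\<^sup>2 / 8"
  proof -
    have "1 / (p - 1) * (1 - p) = -1" using p by (simp add: field_simps)
    hence "K powr (1 - p) = (8 / \<epsilon>\<^sup>2) powr (-1)" unfolding K(1) powr_powr by simp
    thus ?thesis using \<epsilon> by (simp add: powr_minus)
  qed
  \<comment> \<open>The truncated tail uses up exactly a quarter of
    \<open>m * \<epsilon>\<^sup>2\<close>. After squaring, \<open>9 / 16\<close> confronts the
    \<open>1 / 4\<close> allowed by \<open>K(2)\<close>.\<close>
  finally have "3 / 4 * m * \<epsilon>\<^sup>2 \<le> K * expectation (\<lambda>\<omega>. \<bar>S \<omega>\<bar>)" by simp
  hence "(3 / 4 * m * \<epsilon>\<^sup>2)\<^sup>2 \<le> (K * expectation (\<lambda>\<omega>. \<bar>S \<omega>\<bar>))\<^sup>2" by (intro power_mono) auto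
  also have "\<dots> \<le> K\<^sup>2 * expectation (\<lambda>\<omega>. (S \<omega>)\<^sup>2)"
    unfolding power_mult_distrib using Sm Sb by (intro mult_left_mono expectation_abs_sq_le) auto
  also have "\<dots> \<le> m^2 * (\<epsilon> ^ 4 / 4)"
    by (rule order_trans[OF mult_left_mono[OF S2] K(2)]) simp
  finally have "9 / 16 * (m^2 * \<epsilon> ^ 4) \<le> 1 / 4 * (m^2 * \<epsilon> ^ 4)"
    by (simp add: power_mult_distrib power_divide flip: power_mult)
  moreover have "0 < m^2 * \<epsilon> ^ 4" using m \<epsilon> by simp
  ultimately show False by linarith
qed

end

section \<open>The concentration theorem\<close>

lemma exp_ge_quadratic: "(y::real) \<ge> 0 \<Longrightarrow> 1 + y + y\<^sup>2 / 2 \<le> exp y"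
  by (rule exp_lower_Taylor_quadratic)

text \<open>With \<open>x\<close> for \<open>1 / (\<epsilon> ^ 8 * (p - 1)\<^sup>2)\<close>, so
  \<open>T = 34 * k\<^sup>2 * x\<close>, the exponents are compared by inequalities affine in
  \<open>x \<ge> 1\<close>. The factor 34 makes \<open>T / 8\<close> at least
  \<open>3 / 4 * k\<^sup>2 + k + 4 + 63 / 10 * x\<close>.\<close>

lemma constant_bounds:
  fixes p \<epsilon> T \<tau> K :: real and k n N m :: nat
  assumes p: "1 < p" "p \<le> 2" and \<epsilon>: "0 < \<epsilon>" "\<epsilon> \<le> 1" and k: "k \<ge> 2"
    and T: "T = 34 / (\<epsilon> ^ 8 * (p - 1)\<^sup>2) * real k ^ 2" and n: "real n \<ge> exp T"
    and N: "N = n div (2 * k)" and m: "m = n div k" and \<tau>: "\<tau> = exp (k - T / 8)"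
    and K: "K = (8 / \<epsilon>\<^sup>2) powr (1 / (p - 1))"
  shows "n \<ge> 4" "N > 0" "\<tau> \<le> 1" "14 * (1 / exp T) + 3 / N \<le> \<tau> ^ 8" "m > 0"
    "K\<^sup>2 * (m + m^2 * (2 ^ (k choose 2) * (6 * (k choose 2) * \<tau>))) \<le> m^2 * (\<epsilon> ^ 4 / 4)"
proof -
  define y where "y = 1 / \<epsilon> ^ 8"
  define x where "x = y * (1 / (p - 1)\<^sup>2)"
  have y1: "1 \<le> y" unfolding y_def using \<epsilon> by (simp add: power_le_one)
  \<comment> \<open>This is where \<open>p \<le> 2\<close> enters: the square of
    \<open>1 / (p - 1)\<close> in \<open>T\<close> dominates the first power in the exponent of
    \<open>K\<close>.\<close>
  have p1: "1 \<le> 1 / (p - 1)" using p by simp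
  hence p2: "1 / (p - 1) \<le> 1 / (p - 1)\<^sup>2"
    using p self_le_power[of "1 / (p - 1)" 2] by (simp add: power_divide)
  have x1: "1 \<le> x" unfolding x_def using y1 p1 p2 mult_mono[of 1 y 1 "1 / (p - 1)\<^sup>2"] by simp
  have yx: "y \<le> x" unfolding x_def using y1 p1 p2 mult_left_mono[of 1 "1 / (p - 1)\<^sup>2" y] by simp
  have Tx: "T = 34 * k\<^sup>2 * x" unfolding T x_def y_def by simp
  have k2: "2 \<le> real k" using k by simp
  have kk: "4 \<le> (real k)\<^sup>2" "2 * k \<le> (real k)\<^sup>2"
    using k2 mult_mono[OF k2 k2] by (auto simp: power2_eq_square)
  have T0: "34 * (real k)\<^sup>2 \<le> T" unfolding Tx using x1 mult_left_mono[OF x1, of "34 * (real k)\<^sup>2"] by simp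
  have T8: "8 * k \<le> T" using T0 kk by linarith
  show "\<tau> \<le> 1" unfolding \<tau> using T8 by simp
  have "137 \<le> exp T" using exp_ge_add_one_self[of T] T0 kk by linarith
  hence n137: "137 \<le> real n" using n by linarith
  thus "n \<ge> 4" by linarith
  have e8k: "1 + 8 * k + 32 * (real k)\<^sup>2 \<le> exp (8 * k)"
    using exp_ge_quadratic[of "8 * k"] by (simp add: power_mult_distrib)
  have \<tau>8: "\<tau> ^ 8 = exp (8 * k - T)" unfolding \<tau> by (simp add: field_simps flip: exp_of_nat_mult)
  \<comment> \<open>The surplus \<open>exp (8 * k)\<close> absorbs the division by
    \<open>2 * k\<close> and the rounding; the factor 6 makes \<open>3 / N\<close> at most half of
    \<open>\<tau> ^ 8\<close>.\<close>
  have N_ge: "6 * exp (T - 8 * k) \<le> N"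
  proof -
    have "real n / (2 * k) - 1 \<le> N"
    proof -
      have "n < (N + 1) * (2 * k)"
        unfolding N using k dividend_less_times_div[of "2 * k" n] by (simp add: algebra_simps)
      hence "real n < real ((N + 1) * (2 * k))" by (rule of_nat_less_iff[THEN iffD2])
      thus ?thesis using k2 by (simp add: field_simps)
    qed
    moreover have "6 * exp (T - 8 * k) + 1 \<le> real n / (2 * k)"
    proof -
      have "1 \<le> exp (T - 8 * k)" using T8 by simp
      hence "(6 * exp (T - 8 * k) + 1) * (2 * k) \<le> (14 * k) * exp (T - 8 * k)"
        using k2 by (simp add: algebra_simps)
      also have "\<dots> \<le> exp (8 * k) * exp (T - 8 * k)"
        using e8k kk k2 by (intro mult_right_mono) auto
      also have "\<dots> = exp T" by (simp flip: exp_add)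
      finally show ?thesis using n k2 by (simp add: field_simps)
    qed
    ultimately show ?thesis by linarith
  qed
  hence Npos: "0 < real N" using exp_gt_zero[of "T - 8 * k"] by linarith
  thus "N > 0" by simp
  show "14 * (1 / exp T) + 3 / N \<le> \<tau> ^ 8"
  proof -
    have "3 / N \<le> 3 / (6 * exp (T - 8 * k))" using N_ge Npos by (intro divide_left_mono) auto
    also have "\<dots> = exp (8 * k - T) / 2" by (simp add: exp_diff)
    finally have "3 / N \<le> exp (8 * k - T) / 2" .
    moreover have "14 * (1 / exp T) \<le> exp (8 * k - T) / 2"
      using e8k kk k2 by (simp add: exp_diff divide_right_mono field_simps)
    ultimately show ?thesis unfolding \<tau>8 by linarith
  qed
  \<comment> \<open>A common yardstick: \<open>m\<close> is at least \<open>2 * w\<close>, the block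
    covariance at most \<open>1 / (2 * w)\<close>, and \<open>4 * K\<^sup>2\<close> at most
    \<open>w * \<epsilon> ^ 4\<close>.\<close>
  define w where "w = exp (63 / 10 * x)"
  have w: "w > 0" "w \<ge> 1" unfolding w_def using x1 by auto
  have Tw: "3 * k * w \<le> exp T"
  proof -
    have "1 + (34 * (real k)\<^sup>2 - 63 / 10) * 1 \<le> 1 + (34 * (real k)\<^sup>2 - 63 / 10) * x"
      using x1 kk by (intro add_left_mono mult_left_mono) auto
    also have "\<dots> = 1 + (T - 63 / 10 * x)" unfolding Tx by (simp add: algebra_simps)
    also have "\<dots> \<le> exp (T - 63 / 10 * x)" by (rule exp_ge_add_one_self)
    finally have "3 * k \<le> exp (T - 63 / 10 * x)" using kk by simp
    hence "3 * k * w \<le> exp (T - 63 / 10 * x) * w" using w by (intro mult_right_mono) auto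
    thus ?thesis unfolding w_def by (simp flip: exp_add)
  qed
  have m_ge: "2 * w \<le> m"
  proof -
    have "n < (m + 1) * k"
      unfolding m using k dividend_less_times_div[of k n] by (simp add: algebra_simps)
    hence "real n < real ((m + 1) * k)" by (rule of_nat_less_iff[THEN iffD2])
    hence "3 * k * w < (m + 1) * real k" using Tw n by (simp add: algebra_simps)
    hence "real k * (3 * w) < real k * (m + 1)" by (simp only: mult_ac)
    hence "3 * w < m + 1" using k2 by (simp only: mult_less_cancel_left)
    thus ?thesis using w by linarith
  qed
  hence mpos: "0 < real m" using w by linarith
  thus "m > 0" by simp
  define \<delta> where "\<delta> = 2 ^ (k choose 2) * (6 * (k choose 2) * \<tau>)"
  \<comment> \<open>The number of graphs times the number of edges is at most
    \<open>4 ^ (k choose 2)\<close>, hence at most \<open>exp (3 / 4 * k\<^sup>2)\<close>, since 2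
    is below \<open>exp (3 / 4)\<close>.\<close>
  have \<delta>: "2 * \<delta> \<le> 1 / w"
  proof -
    let ?c = "k choose 2"
    have two: "(2::real) \<le> exp (3 / 4)" using exp_ge_quadratic[of "3 / 4"] by (simp add: power2_eq_square)
    have "real ?c \<le> 2 ^ ?c" using less_exp[of ?c] by (metis of_nat_le_iff of_nat_power of_nat_numeral less_imp_le)
    hence "2 ^ ?c * real ?c \<le> 2 ^ ?c * 2 ^ ?c" by (intro mult_left_mono) auto
    also have "\<dots> \<le> exp (3 / 4) ^ ?c * exp (3 / 4) ^ ?c"
      using two by (intro mult_mono power_mono) auto
    also have "\<dots> = exp (3 / 2 * ?c)" by (simp flip: exp_of_nat_mult exp_add)
    also have "\<dots> \<le> exp (3 / 4 * (real k)\<^sup>2)"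
    proof -
      have "2 * ?c \<le> k * (k - 1)" unfolding choose_two by (rule times_div_less_eq_dividend)
      also have "\<dots> \<le> k * k" by simp
      finally have "2 * ?c \<le> k * k" .
      hence "2 * real ?c \<le> real k * real k" by (metis of_nat_le_iff of_nat_mult of_nat_numeral)
      thus ?thesis by (simp add: power2_eq_square)
    qed
    finally have c: "2 ^ ?c * real ?c \<le> exp (3 / 4 * (real k)\<^sup>2)" .
    have e4: "12 \<le> exp (4::real)" using exp_ge_quadratic[of 4] by simp
    have "2 * \<delta> = 12 * (2 ^ ?c * real ?c) * \<tau>" by (simp add: \<delta>_def)
    also have "\<dots> \<le> exp 4 * exp (3 / 4 * (real k)\<^sup>2) * exp (k - T / 8)"
      unfolding \<tau> using c e4 by (intro mult_mono) auto
    also have "\<dots> = exp (4 + 3 / 4 * (real k)\<^sup>2 + (k - T / 8))" by (simp add: exp_add)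
    also have "\<dots> \<le> exp (- (63 / 10 * x))"
    proof -
      have "(17 / 4 * (real k)\<^sup>2 - 63 / 10) * 1 \<le> (17 / 4 * (real k)\<^sup>2 - 63 / 10) * x"
        using x1 kk by (intro mult_left_mono) auto
      hence "17 / 4 * (real k)\<^sup>2 - 63 / 10 \<le> T / 8 - 63 / 10 * x" unfolding Tx by (simp add: algebra_simps)
      thus ?thesis using kk by simp
    qed
    also have "\<dots> = 1 / w" by (simp add: w_def exp_minus inverse_eq_divide)
    finally show ?thesis .
  qed
  have Kw: "K\<^sup>2 * 4 \<le> w * \<epsilon> ^ 4"
  proof -
    define L where "L = ln (1 / \<epsilon>)"
    \<comment> \<open>The inequality \<open>ln y \<le> y - 1\<close> trades the logarithm of
      \<open>1 / \<epsilon>\<close> for a multiple of \<open>y\<close>, and \<open>y \<le> x\<close>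
      makes it linear in \<open>x\<close>.\<close>
    have "8 * L = ln y" unfolding L_def y_def using \<epsilon> by (simp add: ln_div ln_realpow)
    hence L: "L \<le> (y - 1) / 8" using ln_le_minus_one[of y] y1 by simp
    have eps: "\<epsilon> = exp (- L)" unfolding L_def using \<epsilon> by (simp add: ln_div)
    have two: "(2::real) \<le> exp (3 / 4)" using exp_ge_quadratic[of "3 / 4"] by (simp add: power2_eq_square)
    have "(2::real) ^ 3 \<le> exp (3 / 4) ^ 3" "(2::real) ^ 2 \<le> exp (3 / 4) ^ 2"
      by (rule power_mono[OF two], simp)+
    hence e: "8 \<le> exp (9 / 4 :: real)" "4 \<le> exp (3 / 2 :: real)" by (simp_all flip: exp_of_nat_mult)
    have "8 / \<epsilon>\<^sup>2 \<le> exp (9 / 4) / \<epsilon>\<^sup>2" using e by (intro divide_right_mono) auto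
    also have "\<dots> = exp (9 / 4 + 2 * L)" 
    proof -
      have "\<epsilon>\<^sup>2 = exp (- (2 * L))" unfolding eps by (simp flip: exp_of_nat_mult)
      thus ?thesis by (simp flip: exp_diff)
    qed
    also have "\<dots> \<le> exp (9 / 4 * y)" using L y1 by simp
    finally have "K \<le> exp (9 / 4 * y) powr (1 / (p - 1))" unfolding K using \<epsilon> p by (intro powr_mono2) auto
    also have "\<dots> = exp (9 / 4 * (y * (1 / (p - 1))))" by (simp add: powr_def)
    also have "\<dots> \<le> exp (9 / 4 * x)"
      unfolding x_def using p2 y1 by (intro exp_le_cancel_iff[THEN iffD2] mult_left_mono) auto
    finally have "K \<le> exp (9 / 4 * x)" .
    hence "K\<^sup>2 \<le> exp (9 / 4 * x) ^ 2" unfolding K by (intro power_mono) auto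
    hence K2: "K\<^sup>2 \<le> exp (9 / 2 * x)" by (simp flip: exp_of_nat_mult)
    have "K\<^sup>2 * 4 \<le> exp (9 / 2 * x) * exp (3 / 2)" using K2 e by (intro mult_mono) auto
    also have "\<dots> = exp (9 / 2 * x + 3 / 2 + 4 * L) * \<epsilon> ^ 4"
      unfolding eps by (simp flip: exp_of_nat_mult exp_add)
    \<comment> \<open>As \<open>4 * L \<le> (x - 1) / 2\<close>, the exponent is at most
      \<open>5 * x + 1\<close>, which \<open>63 / 10 * x\<close> covers.\<close>
    also have "\<dots> \<le> w * \<epsilon> ^ 4" unfolding w_def using L yx x1 by (intro mult_right_mono) auto
    finally show ?thesis .
  qed
  have "m + m^2 * \<delta> \<le> m^2 / w"
  proof -
    have "2 * w * m \<le> real m * real m" using m_ge mpos by (intro mult_right_mono) auto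
    hence "real m \<le> m^2 / (2 * w)" using w by (simp add: field_simps power2_eq_square)
    moreover have "m^2 * \<delta> \<le> m^2 * (1 / (2 * w))" using \<delta> by (intro mult_left_mono) auto
    ultimately show ?thesis using w by (simp add: field_simps)
  qed
  hence "K\<^sup>2 * (m + m^2 * \<delta>) \<le> K\<^sup>2 * (m^2 / w)" by (intro mult_left_mono) auto
  also have "\<dots> = (K\<^sup>2 * 4) * (m^2 / (4 * w))" by simp
  also have "\<dots> \<le> (w * \<epsilon> ^ 4) * (m^2 / (4 * w))" using Kw w by (intro mult_right_mono) auto
  also have "\<dots> = m^2 * (\<epsilon> ^ 4 / 4)" using w by simp
  finally show "K\<^sup>2 * (m + m^2 * (2 ^ (k choose 2) * (6 * (k choose 2) * \<tau>))) \<le> m^2 * (\<epsilon> ^ 4 / 4)"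
    unfolding \<delta>_def .
qed

theorem theorem1p4:
  fixes M :: "'a measure" and X :: "nat set \<Rightarrow> 'a \<Rightarrow> real"
    and p \<epsilon> C :: real and k n :: nat
  assumes "prob_space M"
    and "1 < p" "p \<le> 2" "0 < \<epsilon>" "\<epsilon> \<le> 1" "k \<ge> 2"
    and C_def: "C = exp (34 / (\<epsilon> ^ 8 * (p - 1)\<^sup>2) * real k ^ 2)"
    and "real n \<ge> C"
    and meas: "\<And>s. s \<in> binom {1..n} 2 \<Longrightarrow> X s \<in> borel_measurable M"
    and bin: "\<And>s \<omega>. s \<in> binom {1..n} 2 \<Longrightarrow> \<omega> \<in> space M \<Longrightarrow> X s \<omega> \<in> {0, 1}"
    and spr: "spreadable M X 2 n (1 / C)"
    and box: "\<bar>(\<integral>\<omega>. X {1,3} \<omega> * X {1,4} \<omega> * X {2,3} \<omega> * X {2,4} \<omega> \<partial>M)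
              - (\<integral>\<omega>. X {1,3} \<omega> \<partial>M) * (\<integral>\<omega>. X {1,4} \<omega> \<partial>M)
                * (\<integral>\<omega>. X {2,3} \<omega> \<partial>M) * (\<integral>\<omega>. X {2,4} \<omega> \<partial>M)\<bar> \<le> 1 / C"
  shows "\<forall>f :: (nat set \<Rightarrow> real) \<Rightarrow> real.
           (\<integral>\<omega>. apply_array f X 2 n \<omega> \<partial>M) = 0 \<and>
           (\<integral>\<omega>. \<bar>apply_array f X 2 n \<omega>\<bar> powr p \<partial>M) powr (1 / p) = 1 \<longrightarrow>
           (\<exists>a. {a..<a + k} \<subseteq> {1..n} \<and>
              (\<forall>J. J \<subseteq> {a..<a + k} \<and> card J \<ge> 2 \<longrightarrow>
                 measure M {\<omega> \<in> space M.
                    \<bar>real_cond_exp M (gen_sigma M X 2 J) (apply_array f X 2 n) \<omega>\<bar> \<le> \<epsilon>}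
                 \<ge> 1 - \<epsilon>))"
proof (intro allI impI, elim conjE)
  fix f :: "(nat set \<Rightarrow> real) \<Rightarrow> real"
  assume f0: "(\<integral>\<omega>. apply_array f X 2 n \<omega> \<partial>M) = 0"
    and f1: "(\<integral>\<omega>. \<bar>apply_array f X 2 n \<omega>\<bar> powr p \<partial>M) powr (1 / p) = 1"
  define T where "T = 34 / (\<epsilon> ^ 8 * (p - 1)\<^sup>2) * real k ^ 2"
  have C: "C = exp T" by (simp add: C_def T_def)
  define N where "N = n div (2 * k)"
  define m where "m = n div k"
  define \<tau> where "\<tau> = exp (k - T / 8)"
  define K where "K = (8 / \<epsilon>\<^sup>2) powr (1 / (p - 1))"
  have "real n \<ge> exp T" using assms(8) C by simp
  note const = constant_bounds[OF assms(2-6) T_def this N_def m_def \<tau>_def K_def]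
  interpret binary_array M X n "1 / C"
    using assms(1) meas bin spr by (intro binary_array.intro binary_array_axioms.intro)
  have unit: "0 \<le> (\<integral>\<omega>. X {i, j} \<omega> \<partial>M) \<and> (\<integral>\<omega>. X {i, j} \<omega> \<partial>M) \<le> 1"
    if "1 \<le> i" "i < j" "j \<le> n" for i j
    using X_meas[of i j] X_bounds[of i j] that by (intro expectation_unit_interval) auto
  \<comment> \<open>Each of the four edge means exceeds that of \<open>X {1,2}\<close> by at most
    \<open>1 / C\<close>; together with the box condition this gives the five errors required by the
    locale.\<close>
  have "(\<integral>\<omega>. X {1,3} \<omega> \<partial>M) * (\<integral>\<omega>. X {1,4} \<omega> \<partial>M) * (\<integral>\<omega>. X {2,3} \<omega> \<partial>M) * (\<integral>\<omega>. X {2,4} \<omega> \<partial>M)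
      \<le> (\<integral>\<omega>. X {1,2} \<omega> \<partial>M) ^ 4 + 4 * (1 / C)"
  proof -
    define P where "P = (\<integral>\<omega>. X {1,2} \<omega> \<partial>M)"
    have P: "0 \<le> P" "P \<le> 1" using unit[of 1 2] const(1) by (auto simp: P_def)
    have C0: "0 \<le> 1 / C" by (simp add: C)
    have E: "(\<integral>\<omega>. X {i, j} \<omega> \<partial>M) \<le> P + 1 / C" "0 \<le> (\<integral>\<omega>. X {i, j} \<omega> \<partial>M)" "(\<integral>\<omega>. X {i, j} \<omega> \<partial>M) \<le> 1"
      if "1 \<le> i" "i < j" "j \<le> n" for i j
      using edge_transfer[OF that] unit[OF that] const(1) by (auto simp: P_def abs_le_iff)
    have P2: "0 \<le> P * P" "P * P \<le> 1" "0 \<le> P * (P * P)" "P * (P * P) \<le> 1"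
      using P by (auto intro!: mult_le_one)
    have "(\<integral>\<omega>. X {1,3} \<omega> \<partial>M) * ((\<integral>\<omega>. X {1,4} \<omega> \<partial>M) * ((\<integral>\<omega>. X {2,3} \<omega> \<partial>M) * (\<integral>\<omega>. X {2,4} \<omega> \<partial>M)))
      \<le> P * (P * (P * P)) + (1 / C + (1 / C + (1 / C + 1 / C)))"
      using const(1) P P2 C0 by (intro mult_perturbation E add_nonneg_nonneg) auto
    thus ?thesis by (simp add: P_def power4_eq_xxxx mult.assoc)
  qed
  hence box': "(\<integral>\<omega>. X {1,3} \<omega> * X {1,4} \<omega> * X {2,3} \<omega> * X {2,4} \<omega> \<partial>M)
      \<le> (\<integral>\<omega>. X {1,2} \<omega> \<partial>M) ^ 4 + 5 * (1 / C)"
    using box by linarith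
  interpret quasirandom_array M X n "1 / C" \<tau> N
  proof
    show "14 * (1 / C) + 3 / real N \<le> \<tau> ^ 8" using const(4) by (simp add: C)
  qed (use const box' in \<open>auto simp: C \<tau>_def\<close>)
  have "(\<integral>\<omega>. \<bar>apply_array f X 2 n \<omega>\<bar> powr p \<partial>M) = 1"
  proof -
    let ?I = "\<integral>\<omega>. \<bar>apply_array f X 2 n \<omega>\<bar> powr p \<partial>M"
    have "0 \<le> ?I" by (intro Bochner_Integration.integral_nonneg) simp
    hence "?I = (?I powr (1 / p)) powr p" using assms(2) by (simp add: powr_powr)
    thus ?thesis using f1 by simp
  qed
  moreover have "m * k \<le> n" by (simp add: m_def)
  moreover have "2 * k * N \<le> n" by (simp add: N_def)
  ultimately obtain l where l: "l < m" and conc: "\<And>J. J \<subseteq> {1 + l * k..<1 + l * k + k} \<Longrightarrow>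
      1 - \<epsilon> \<le> measure M {\<omega> \<in> space M. \<bar>real_cond_exp M (gen_sigma M X 2 J) (apply_array f X 2 n) \<omega>\<bar> \<le> \<epsilon>}"
    using concentration_on_some_block[OF apply_array_determined f0 _ assms(2,4) const(5) _ _ K_def const(6)] by blast
  have "Suc l * k \<le> m * k" using l by (intro mult_right_mono) auto
  hence "l * k + k \<le> n" using \<open>m * k \<le> n\<close> by simp
  hence "{1 + l * k..<1 + l * k + k} \<subseteq> {1..n}" by auto
  thus "\<exists>a. {a..<a + k} \<subseteq> {1..n} \<and>
      (\<forall>J. J \<subseteq> {a..<a + k} \<and> card J \<ge> 2 \<longrightarrow>
         measure M {\<omega> \<in> space M. \<bar>real_cond_exp M (gen_sigma M X 2 J) (apply_array f X 2 n) \<omega>\<bar> \<le> \<epsilon>} \<ge> 1 - \<epsilon>)"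
    using conc by blast
qed

end
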